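(* Let $p\ge 1$ be an integer and let $a_0,\ldots,a_p\in\mathbb{C}$ with $a_p\neq 0$. Let $(Q_n)_{n\ge 0}$, the functions $z_0,\ldots,z_p$, the set $\Gamma_1$, the resolvent functions $g_1,\ldots,g_p$, the linear functionals $L_1,\ldots,L_p$, and, for $n\in\mathbb{Z}_+$, the multi-index $\mathbf{n}=(n_1,\ldots,n_p)$ be as defined in the context. Then: (i) $(g_1(\lambda),\ldots,g_p(\lambda))=(z_0(\lambda),\ldots,z_0^p(\lambda))$; more precisely, both vector functions have the same Laurent expansions at $\infty$ componentwise. (ii) For every $n\in\mathbb{Z}_+$ and each $j\in\{1,\ldots,p\}$, $$L_j(\lambda^k Q_n(\lambda))=0,\qquad k=0,\ldots,n_j-1.$$ (iii) For every $n\in\mathbb{Z}_+$ the vector rational function $$\Big(\frac{Q_{n-1}}{Q_n},\frac{Q_{n-2}}{Q_n},\ldots,\frac{Q_{n-p}}{Q_n}\Big)$$ is a type II Hermite-Padé approximant to the system $(z_0,z_0^2,\ldots,z_0^p)$ with respect to the multi-index $\mathbf{n}$; that is, for each $j=1,\ldots,p$, $$Q_n(\lambda)z_0^j(\lambda)-Q_{n-j}(\lambda)=\mathcal{O}\Big(\frac{1}{\lambda^{n_j+1}}\Big),\qquad \lambda\to\infty.$$ (iv) For each $j=1,\ldots,p$, $$\lim_{n\to\infty}\frac{Q_{n-j}(\lambda)}{Q_n(\lambda)}=z_0^j(\lambda)$$ uniformly on each compact subset of $\overline{\mathbb{C}}\setminus\Gamma_1$.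
   Context: Polynomials: $(Q_n)_{n\ge0}$ is the sequence of monic polynomials defined by $$\lambda Q_n(\lambda)=Q_{n+1}(\lambda)+a_0Q_n(\lambda)+\cdots+a_pQ_{n-p}(\lambda),\quad n\ge0,$$ with $Q_0\equiv1$, $Q_{-1}=\cdots=Q_{-p}\equiv0$. Matrix: $A=(A_{i,j})_{i,j\ge0}$ is the infinite banded Toeplitz (Hessenberg) matrix with $A_{i,i+1}=1$, $A_{i,i-k}=a_k$ for $0\le k\le p$ (when $i-k\ge0$), and all other entries $0$. It defines a bounded operator on $\ell^2$ with the standard inner product $(\cdot,\cdot)$. $\mathbf{e}_j$ ($j\ge0$) is the unit vector of $\ell^2$ with $1$ in component $j+1$ (i.e. the basis vector with index $j$ when indices start at $0$). Resolvent functions: $g_j(\lambda)=((\lambda I-A)^{-1}\mathbf{e}_{j-1},\mathbf{e}_0)$, $1\le j\le p$; these are analytic near $\infty$ with $g_j(\infty)=0$. Functionals: for $j=1,\ldots,p$, $L_j$ is the linear functional on polynomials determined by $L_j(z^n)=(A^n\mathbf{v}_j,\mathbf{e}_0)$, $n\ge 0$, where $\mathbf{v}_j=\mathbf{e}_0+\cdots+\mathbf{e}_{j-1}$. Multi-index: for $n\in\mathbb{Z}_+$ write $n=mp+k$ with $m\in\mathbb{Z}_+$, $k\in\{0,\ldots,p-1\}$; then $\mathbf{n}=(n_1,\ldots,n_p)$ has $n_1=\cdots=n_k=m+1$ and $n_{k+1}=\cdots=n_p=m$. Algebraic function: let $a(z)=z^{-1}+\sum_{k=0}^pa_kz^k$.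 For $\lambda\in\mathbb{C}$, $z_0(\lambda),\ldots,z_p(\lambda)$ are the $p+1$ solutions of $a(z)=\lambda$ (with multiplicity), ordered so that $0<|z_0(\lambda)|\le\cdots\le|z_p(\lambda)|$ (any ordering compatible with these inequalities is chosen when equalities occur). $\Gamma_1=\{\lambda\in\mathbb{C}:|z_0(\lambda)|=|z_1(\lambda)|\}$, which is a compact set. $z_0$ is analytic in a neighborhood of $\infty$ with a simple zero at $\infty$, $z_0(\infty)=0$. *)

theory Defs
  imports
    "HOL-Complex_Analysis.Complex_Analysis"
    "HOL-Library.Landau_Symbols"
begin

text \<open>The coefficients \<open>a\<^sub>0, \<dots>, a\<^sub>p\<close> are the values \<open>a 0, \<dots>, a p\<close> of a function
  \<open>a :: nat \<Rightarrow> complex\<close>; values beyond \<open>p\<close> play no role.\<close>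

text \<open>The index is an integer so that \<open>Q (-p), \<dots>, Q (-1)\<close> make sense.
  Values below \<open>-p\<close> are unconstrained and never used.\<close>

definition Q_sequence :: "nat \<Rightarrow> (nat \<Rightarrow> complex) \<Rightarrow> (int \<Rightarrow> complex poly) \<Rightarrow> bool" where
  "Q_sequence p a Q \<longleftrightarrow>
     Q 0 = 1 \<and>
     (\<forall>k. 1 \<le> k \<and> k \<le> int p \<longrightarrow> Q (- k) = 0) \<and>
     (\<forall>n\<ge>0. [:0, 1:] * Q n = Q (n + 1) + (\<Sum>k\<le>p. smult (a k) (Q (n - int k))))"

definition toeplitz :: "nat \<Rightarrow> (nat \<Rightarrow> complex) \<Rightarrow> nat \<Rightarrow> nat \<Rightarrow> complex" where
  "toeplitz p a i j =
     (if j = i + 1 then 1 else if j \<le> i \<and> i - j \<le> p then a (i - j) else 0)"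

definition ell2 :: "(nat \<Rightarrow> complex) set" where
  "ell2 = {x. summable (\<lambda>i. (cmod (x i))\<^sup>2)}"

definition ell2_inner :: "(nat \<Rightarrow> complex) \<Rightarrow> (nat \<Rightarrow> complex) \<Rightarrow> complex" where
  "ell2_inner x y = (\<Sum>i. x i * cnj (y i))"

text \<open>Each row of \<open>toeplitz p a\<close> is finitely supported, so for that matrix the series
  below is a finite sum for every sequence \<open>x\<close>.\<close>

definition mat_apply :: "(nat \<Rightarrow> nat \<Rightarrow> complex) \<Rightarrow> (nat \<Rightarrow> complex) \<Rightarrow> nat \<Rightarrow> complex" where
  "mat_apply M x i = (\<Sum>j. M i j * x j)"

definition basis_vec :: "nat \<Rightarrow> nat \<Rightarrow> complex" where
  "basis_vec j i = (if i = j then 1 else 0)"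

text \<open>\<open>resolvent_op M l y\<close> is the unique \<open>x\<close> in \<open>ell2\<close> with \<open>(l I - M) x = y\<close>.
  On the resolvent set of a bounded operator, \<open>l I - M\<close> is a bijection of \<open>ell2\<close>, and this is
  the usual resolvent; its boundedness is automatic by the open mapping theorem.\<close>

definition resolvent_op ::
    "(nat \<Rightarrow> nat \<Rightarrow> complex) \<Rightarrow> complex \<Rightarrow> (nat \<Rightarrow> complex) \<Rightarrow> nat \<Rightarrow> complex" where
  "resolvent_op M l = the_inv_into ell2 (\<lambda>x i. l * x i - mat_apply M x i)"

definition resolvent_fun :: "nat \<Rightarrow> (nat \<Rightarrow> complex) \<Rightarrow> nat \<Rightarrow> complex \<Rightarrow> complex" where
  "resolvent_fun p a j l =
     ell2_inner (resolvent_op (toeplitz p a) l (basis_vec (j - 1))) (basis_vec 0)"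

definition L_moment :: "nat \<Rightarrow> (nat \<Rightarrow> complex) \<Rightarrow> nat \<Rightarrow> nat \<Rightarrow> complex" where
  "L_moment p a j n =
     ell2_inner ((mat_apply (toeplitz p a) ^^ n) (\<lambda>i. \<Sum>l<j. basis_vec l i)) (basis_vec 0)"

definition L_functional :: "nat \<Rightarrow> (nat \<Rightarrow> complex) \<Rightarrow> nat \<Rightarrow> complex poly \<Rightarrow> complex" where
  "L_functional p a j P = (\<Sum>n\<le>degree P. coeff P n * L_moment p a j n)"

text \<open>The component \<open>n\<^sub>j\<close>, \<open>1 \<le> j \<le> p\<close>, of the multi-index of \<open>n = m p + k\<close>, \<open>0 \<le> k < p\<close>.\<close>

definition multi_index :: "nat \<Rightarrow> nat \<Rightarrow> nat \<Rightarrow> nat" where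
  "multi_index p n j = (if j \<le> n mod p then n div p + 1 else n div p)"

definition symbol :: "nat \<Rightarrow> (nat \<Rightarrow> complex) \<Rightarrow> complex \<Rightarrow> complex" where
  "symbol p a z = inverse z + (\<Sum>k\<le>p. a k * z ^ k)"

text \<open>\<open>z 0 l, \<dots>, z p l\<close> list the solutions of \<open>symbol p a w = l\<close> in the punctured plane, each
  repeated according to its multiplicity as a zero of \<open>symbol p a - l\<close>, by increasing modulus.
  (\<open>zorder\<close> is \<open>0\<close> at a point where the function is analytic and nonzero.)\<close>

definition ordered_solutions ::
    "nat \<Rightarrow> (nat \<Rightarrow> complex) \<Rightarrow> (nat \<Rightarrow> complex \<Rightarrow> complex) \<Rightarrow> bool" where
  "ordered_solutions p a z \<longleftrightarrow>
     (\<forall>l. (\<forall>i\<le>p. z i l \<noteq> 0 \<and> symbol p a (z i l) = l) \<and>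
          (\<forall>w. w \<noteq> 0 \<longrightarrow>
             int (card {i. i \<le> p \<and> z i l = w}) = zorder (\<lambda>x. symbol p a x - l) w) \<and>
          (\<forall>i<p. cmod (z i l) \<le> cmod (z (Suc i) l)))"

definition Gamma1 :: "(nat \<Rightarrow> complex \<Rightarrow> complex) \<Rightarrow> complex set" where
  "Gamma1 z = {l. cmod (z 0 l) = cmod (z 1 l)}"

text \<open>\<open>(P 1 / Q, \<dots>, P p / Q)\<close> is a type II Hermite-Pade approximant to \<open>(f 1, \<dots>, f p)\<close> (functions
  given near infinity) with respect to the multi-index \<open>(N 1, \<dots>, N p)\<close>.\<close>

definition type_II_hermite_pade ::
    "nat \<Rightarrow> (nat \<Rightarrow> nat) \<Rightarrow> (nat \<Rightarrow> complex \<Rightarrow> complex) \<Rightarrow> complex poly \<Rightarrow> (nat \<Rightarrow> complex poly) \<Rightarrow> bool"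
  where
  "type_II_hermite_pade p N f Q P \<longleftrightarrow>
     Q \<noteq> 0 \<and> degree Q \<le> (\<Sum>j=1..p. N j) \<and>
     (\<forall>j\<in>{1..p}.
        (\<lambda>l. poly Q l * f j l - poly (P j) l) \<in> O[at_infinity](\<lambda>l. 1 / l ^ (N j + 1)))"

text \<open>The Riemann sphere, with \<open>None\<close> as the point at infinity.\<close>

abbreviation riemann_sphere :: "complex option topology" where
  "riemann_sphere \<equiv> Alexandroff_compactification euclidean"

definition sphere_ext :: "(complex \<Rightarrow> complex) \<Rightarrow> complex option \<Rightarrow> complex" where
  "sphere_ext f x = (case x of Some l \<Rightarrow> f l | None \<Rightarrow> Lim at_infinity f)"

end

theory Submission
  imports
    Defs
    "HOL-Computational_Algebra.Fundamental_Theorem_Algebra"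
    "HOL-Real_Asymp.Real_Asymp"
begin

text \<open>
  The generating function of \<open>Q\<^sub>n(l)\<close> is \<open>1 / \<Prod>\<^sub>i (1 - t / z\<^sub>i(l))\<close>. Dividing out the factor of
  \<open>z\<^sub>0\<close> leaves coefficients \<open>h\<^sub>n = Q\<^sub>n - Q\<^sub>n\<^sub>-\<^sub>1 / z\<^sub>0\<close>, and \<open>Q\<^sub>n z\<^sub>0\<^sup>j - Q\<^sub>n\<^sub>-\<^sub>j\<close> telescopes into the sum of
  \<open>z\<^sub>0\<^sup>j\<^sup>-\<^sup>i h\<^sub>n\<^sub>-\<^sub>i\<close> over \<open>i < j\<close>. Inserting \<open>l = a(z\<^sub>0)\<close> into the recurrence for \<open>Q\<close> shows that \<open>h\<^sub>n\<close> is
  a combination of the \<open>p\<close> preceding \<open>h\<^sub>m\<close> whose coefficients all contain a factor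
  \<open>z\<^sub>0 = O(1/l)\<close>; this gives the order of the Hermite-Pade remainder. It also gives geometric
  decay of \<open>h\<^sub>n\<close> for large \<open>l\<close>, so that \<open>Q\<^sub>n z\<^sub>0\<^sup>j - Q\<^sub>n\<^sub>-\<^sub>j\<close>, as a sequence in \<open>n\<close>, is the square summable
  solution of the resolvent equation; its entry at \<open>0\<close> is \<open>z\<^sub>0\<^sup>j\<close>. Orthogonality holds because the
  first row of \<open>Q\<^sub>n(A)\<close> is the \<open>n\<close>-th unit vector, whereas \<open>A\<^sup>k v\<^sub>j\<close> vanishes from index \<open>j + k p\<close> on.
  Finally, if \<open>|z\<^sub>0| \<le> \<rho> |z\<^sub>1|\<close> with \<open>\<rho> < 1\<close>, then \<open>z\<^sub>0\<^sup>n h\<^sub>n\<close> is at most \<open>(n + 1)\<^sup>p \<rho>\<^sup>n\<close>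
  in modulus while \<open>z\<^sub>0\<^sup>n Q\<^sub>n\<close> stays away from \<open>0\<close>; such a \<open>\<rho>\<close> exists on compact sets
  avoiding \<open>\<Gamma>\<^sub>1\<close>, by compactness and continuity of roots.
\<close>

section \<open>Products of geometric power series\<close>

lemma linear_times_geometric_fps:
  fixes u :: complex
  shows "(1 - fps_const u * fps_X) * Abs_fps (\<lambda>n. u ^ n) = 1"
  by (rule fps_ext) (auto simp: left_diff_distrib mult.assoc power_eq_if[of _ "_::nat"])

text \<open>Restoring one factor at a time convolves the coefficients with a geometric sequence; the
  at most n + 1 terms of each convolution cost one more power of n + 1.\<close>

lemma prod_linear_inverse_coeff_le:
  fixes u :: "'i \<Rightarrow> complex"
  assumes "finite I"
    and "F * (\<Prod>i\<in>I. 1 - fps_const (u i) * fps_X) = 1"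
    and "\<And>i. i \<in> I \<Longrightarrow> cmod (u i) \<le> r" and "r \<ge> 0"
  shows "cmod (fps_nth F n) \<le> real (n + 1) ^ card I * r ^ n"
  using assms
proof (induction I arbitrary: F n rule: finite_induct)
  case empty
  thus ?case by (cases n) auto
next
  case (insert i I)
  define G where "G = F * (1 - fps_const (u i) * fps_X)"
  have G: "G * (\<Prod>i\<in>I. 1 - fps_const (u i) * fps_X) = 1"
    using insert by (simp add: G_def mult_ac)
  have F: "F = G * Abs_fps (\<lambda>n. u i ^ n)"
    by (simp add: G_def mult.assoc linear_times_geometric_fps)
  have "cmod (fps_nth F n) \<le> (\<Sum>m\<le>n. cmod (fps_nth G m) * cmod (u i) ^ (n - m))"
    unfolding F fps_mult_nth by (auto intro!: sum_norm_le simp: norm_mult norm_power atMost_atLeast0)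
  also have "\<dots> \<le> (\<Sum>m\<le>n. real (n + 1) ^ card I * r ^ n)"
  proof (intro sum_mono)
    fix m assume m: "m \<in> {..n}"
    have "cmod (fps_nth G m) \<le> real (m + 1) ^ card I * r ^ m"
      using insert G by blast
    also have "\<dots> \<le> real (n + 1) ^ card I * r ^ m"
      using m insert by (intro mult_right_mono power_mono) auto
    finally have "cmod (fps_nth G m) * cmod (u i) ^ (n - m)
        \<le> (real (n + 1) ^ card I * r ^ m) * r ^ (n - m)"
      using insert by (intro mult_mono power_mono) auto
    also have "\<dots> = real (n + 1) ^ card I * r ^ n"
      using m by (simp add: mult.assoc flip: power_add)
    finally show "cmod (fps_nth G m) * cmod (u i) ^ (n - m) \<le> real (n + 1) ^ card I * r ^ n" .
  qed
  also have "\<dots> = real (n + 1) ^ card (insert i I) * r ^ n"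
    using insert by simp
  finally show ?case .
qed

lemma summable_poly_geometric:
  fixes r :: real
  assumes "0 \<le> r" "r < 1"
  shows "summable (\<lambda>n. real (n + 1) ^ k * r ^ n)"
proof -
  \<comment> \<open>A ratio strictly between r and 1 absorbs the polynomial factor.\<close>
  obtain s where s: "r < s" "s < 1"
    using assms dense by blast
  show ?thesis
  proof (cases "r = 0")
    case True
    thus ?thesis by (intro summable_finite[of "{0}"]) auto
  next
    case False
    hence "r > 0" using assms by simp
    hence "(\<lambda>n. real (n + 1) ^ k * r ^ n) \<in> O(\<lambda>n. s ^ n)"
      using s by real_asymp
    thus ?thesis
      by (rule summable_comparison_test_bigo[rotated]) (use s assms in \<open>auto intro!: summable_geometric\<close>)
  qed
qed

text \<open>The formal reciprocal becomes a numerical one through Cauchy products of absolutely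
  convergent series. Absolute convergence for |w| r < 1 comes from the preceding coefficient
  bound.\<close>

lemma prod_linear_inverse_sums:
  fixes u :: "'i \<Rightarrow> complex" and w :: complex
  assumes "finite I"
    and "F * (\<Prod>i\<in>I. 1 - fps_const (u i) * fps_X) = 1"
    and "\<And>i. i \<in> I \<Longrightarrow> cmod (u i) \<le> r" and "r \<ge> 0" and w: "cmod w * r < 1"
  shows "(\<lambda>n. fps_nth F n * w ^ n) sums inverse (\<Prod>i\<in>I. 1 - u i * w)"
  using assms(1-4)
proof (induction I arbitrary: F rule: finite_induct)
  case empty
  have "(\<lambda>n. fps_nth F n * w ^ n) sums (\<Sum>n\<in>{0}. fps_nth F n * w ^ n)"
    using empty by (intro sums_finite) auto
  thus ?case using empty by simp
next
  case (insert i I)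
  define G where "G = F * (1 - fps_const (u i) * fps_X)"
  have G: "G * (\<Prod>i\<in>I. 1 - fps_const (u i) * fps_X) = 1"
    using insert by (simp add: G_def mult_ac)
  have F: "F = G * Abs_fps (\<lambda>n. u i ^ n)"
    by (simp add: G_def mult.assoc linear_times_geometric_fps)
  have small: "cmod (u i * w) < 1"
    using w insert.prems(2)[of i] mult_right_mono[of "cmod (u i)" r "cmod w"]
    by (simp add: norm_mult mult.commute)
  have sumG: "summable (\<lambda>n. cmod (fps_nth G n * w ^ n))"
  proof (rule summable_comparison_test)
    show "\<exists>N. \<forall>n\<ge>N. norm (cmod (fps_nth G n * w ^ n)) \<le> real (n + 1) ^ card I * (cmod w * r) ^ n"
    proof (intro exI[of _ 0] allI impI)
      fix n
      have "cmod (fps_nth G n) * cmod w ^ n \<le> (real (n + 1) ^ card I * r ^ n) * cmod w ^ n"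
        using insert G by (intro mult_right_mono prod_linear_inverse_coeff_le) auto
      thus "norm (cmod (fps_nth G n * w ^ n)) \<le> real (n + 1) ^ card I * (cmod w * r) ^ n"
        by (simp add: norm_mult norm_power power_mult_distrib mult_ac)
    qed
  next
    show "summable (\<lambda>n. real (n + 1) ^ card I * (cmod w * r) ^ n)"
      using insert.prems w by (intro summable_poly_geometric mult_nonneg_nonneg) auto
  qed
  have "(\<lambda>n. \<Sum>m\<le>n. (fps_nth G m * w ^ m) * (u i * w) ^ (n - m)) sums
      ((\<Sum>n. fps_nth G n * w ^ n) * (\<Sum>n. (u i * w) ^ n))"
    using small sumG by (intro Cauchy_product_sums) (auto simp: norm_power intro!: summable_geometric)
  also have "(\<Sum>n. fps_nth G n * w ^ n) = inverse (\<Prod>i\<in>I. 1 - u i * w)"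
    using insert G by (intro sums_unique[symmetric] insert.IH) auto
  also have "(\<Sum>n. (u i * w) ^ n) = inverse (1 - u i * w)"
    using suminf_geometric[OF small] by (simp add: field_simps)
  also have "(\<lambda>n. \<Sum>m\<le>n. (fps_nth G m * w ^ m) * (u i * w) ^ (n - m)) = (\<lambda>n. fps_nth F n * w ^ n)"
  proof
    fix n
    have "(fps_nth G m * w ^ m) * (u i * w) ^ (n - m) = fps_nth G m * u i ^ (n - m) * w ^ n"
      if "m \<le> n" for m
      using that power_add[of w m "n - m"] by (simp add: power_mult_distrib)
    hence "(\<Sum>m\<le>n. (fps_nth G m * w ^ m) * (u i * w) ^ (n - m)) =
        (\<Sum>m\<le>n. fps_nth G m * u i ^ (n - m) * w ^ n)"
      by (intro sum.cong) auto
    thus "(\<Sum>m\<le>n. (fps_nth G m * w ^ m) * (u i * w) ^ (n - m)) = fps_nth F n * w ^ n"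
      by (simp add: F fps_mult_nth sum_distrib_right atMost_atLeast0)
  qed
  finally show ?case
    using insert by (simp add: mult.commute)
qed

section \<open>Limits of families of roots\<close>

text \<open>One subsequence has to serve all roots at once. It is refined index by index, and limits
  already obtained survive a further refinement.\<close>

lemma bounded_family_convergent_subseq:
  fixes f :: "'i \<Rightarrow> nat \<Rightarrow> 'a::heine_borel"
  assumes "finite I" and "\<And>i. i \<in> I \<Longrightarrow> bounded (range (f i))"
  obtains r :: "nat \<Rightarrow> nat" and v where "strict_mono r" "\<And>i. i \<in> I \<Longrightarrow> (f i \<circ> r) \<longlonglongrightarrow> v i"
proof -
  have "\<exists>r v. strict_mono (r :: nat \<Rightarrow> nat) \<and> (\<forall>i\<in>I. (f i \<circ> r) \<longlonglongrightarrow> v i)"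
    using assms
  proof (induction I rule: finite_induct)
    case empty
    show ?case by (auto intro: exI[of _ id] strict_mono_id)
  next
    case (insert j I)
    then obtain r v where r: "strict_mono (r :: nat \<Rightarrow> nat)" "\<forall>i\<in>I. (f i \<circ> r) \<longlonglongrightarrow> v i"
      by blast
    have "bounded (range (f j \<circ> r))"
      using insert.prems[of j] by (rule bounded_subset) auto
    then obtain y s where s: "strict_mono (s :: nat \<Rightarrow> nat)" "(f j \<circ> r \<circ> s) \<longlonglongrightarrow> y"
      using bounded_imp_convergent_subsequence by blast
    have "(f i \<circ> (r \<circ> s)) \<longlonglongrightarrow> (v(j := y)) i" if "i \<in> insert j I" for i
      using that s r LIMSEQ_subseq_LIMSEQ[of "f i \<circ> r" "v i" s] insert.hyps
      by (auto simp: o_assoc)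
    moreover have "strict_mono (r \<circ> s)"
      using r s by (intro strict_mono_o)
    ultimately show ?case by blast
  qed
  thus ?thesis using that by blast
qed

text \<open>Replacing x by 1/x turns the factors into monic linear ones, whose root multiset is
  unique. This also covers u i = 0, which cannot be excluded in advance for a limit of inverse
  roots.\<close>

lemma prod_linear_roots_unique:
  fixes u v :: "nat \<Rightarrow> complex"
  assumes eq: "\<And>x. (\<Prod>i\<le>n. 1 - u i * x) = (\<Prod>i\<le>n. 1 - v i * x)"
  shows "image_mset u (mset_set {..n}) = image_mset v (mset_set {..n})"
proof -
  have roots: "proots (\<Prod>i\<le>n. [:- u i, 1:]) = image_mset u (mset_set {..n})" for u :: "nat \<Rightarrow> complex"
    by (subst proots_prod) (auto simp: sum_unfold_sum_mset)
  have "poly (\<Prod>i\<le>n. [:- u i, 1:]) x = poly (\<Prod>i\<le>n. [:- v i, 1:]) x" if "x \<noteq> 0" for x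
  proof -
    have "poly (\<Prod>i\<le>n. [:- u i, 1:]) x = (\<Prod>i\<le>n. x * (1 - u i * inverse x))" for u :: "nat \<Rightarrow> complex"
      unfolding poly_prod using that by (intro prod.cong) (auto simp: right_diff_distrib)
    thus ?thesis using eq[of "inverse x"] by (simp add: prod.distrib)
  qed
  \<comment> \<open>The substitution says nothing at x = 0. The extra factor X makes the identity
    hold everywhere and is cancelled afterwards.\<close>
  hence "poly ([:0, 1:] * ((\<Prod>i\<le>n. [:- u i, 1:]) - (\<Prod>i\<le>n. [:- v i, 1:]))) x = 0" for x
    by (cases "x = 0") auto
  hence "(\<Prod>i\<le>n. [:- u i, 1:]) = (\<Prod>i\<le>n. [:- v i, 1:])"
    using poly_all_0_iff_0[of "[:0, 1:] * ((\<Prod>i\<le>n. [:- u i, 1:]) - (\<Prod>i\<le>n. [:- v i, 1:]))"] by auto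
  thus ?thesis using roots by metis
qed

text \<open>A multiset has only one monotone enumeration. This recovers the moduli index by index
  after a limit argument has identified them only as a multiset.\<close>

lemma antimono_image_mset_eq:
  fixes f g :: "nat \<Rightarrow> 'a::linorder"
  assumes "image_mset f (mset_set {..n}) = image_mset g (mset_set {..n})"
    and "\<And>i. i < n \<Longrightarrow> f (Suc i) \<le> f i" "\<And>i. i < n \<Longrightarrow> g (Suc i) \<le> g i"
    and "i \<le> n"
  shows "f i = g i"
proof -
  have anti: "h j \<le> h i" if "\<And>i. i < n \<Longrightarrow> h (Suc i) \<le> h i" "i \<le> j" "j \<le> n" for h :: "nat \<Rightarrow> 'a" and i j
    using that(2,3)
  proof (induction j rule: dec_induct)
    case (step j)
    thus ?case using that(1)[of j] by auto
  qed simp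
  have sorted: "sorted (map h (rev [0..<Suc n]))" if "\<And>i. i < n \<Longrightarrow> h (Suc i) \<le> h i" for h :: "nat \<Rightarrow> 'a"
    unfolding sorted_iff_nth_mono using anti[of h, OF that]
    by (auto simp: rev_nth simp del: upt_Suc)
  have "mset (map f (rev [0..<Suc n])) = mset (map g (rev [0..<Suc n]))"
    using assms(1) by (simp del: upt_Suc add: atLeastLessThanSuc_atLeastAtMost atMost_atLeast0)
  hence "map f (rev [0..<Suc n]) = map g (rev [0..<Suc n])"
    using sorted[of f] sorted[of g] assms(2,3) by (metis properties_for_sort)
  thus ?thesis using assms(4) by (auto simp: rev_map simp del: upt_Suc)
qed

section \<open>Toeplitz action and multi-index\<close>

lemma ell2_inner_basis_0: "ell2_inner x (basis_vec 0) = x 0"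
proof -
  have "(\<Sum>i. x i * cnj (basis_vec 0 i)) = (\<Sum>i\<in>{0}. x i * cnj (basis_vec 0 i))"
    by (intro suminf_finite) (auto simp: basis_vec_def)
  thus ?thesis by (simp add: ell2_inner_def basis_vec_def)
qed

lemma mat_apply_toeplitz:
  "mat_apply (toeplitz p a) x i = x (Suc i) + (\<Sum>k\<le>p. if k \<le> i then a k * x (i - k) else 0)"
proof -
  have "mat_apply (toeplitz p a) x i = (\<Sum>j\<le>Suc i. toeplitz p a i j * x j)"
    unfolding mat_apply_def by (intro suminf_finite) (auto simp: toeplitz_def)
  also have "\<dots> = x (Suc i) + (\<Sum>j\<le>i. if i - j \<le> p then a (i - j) * x j else 0)"
    by (simp add: toeplitz_def if_distrib[of "\<lambda>c. c * _"] cong: if_cong)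
  also have "(\<Sum>j\<le>i. if i - j \<le> p then a (i - j) * x j else 0) =
      (\<Sum>k\<le>i. if k \<le> p then a k * x (i - k) else 0)"
    by (rule sum.reindex_bij_witness[of _ "\<lambda>k. i - k" "\<lambda>k. i - k"]) auto
  also have "\<dots> = (\<Sum>k\<in>{..p} \<inter> {..i}. a k * x (i - k))"
    by (subst Int_commute, subst sum.inter_restrict) auto
  also have "\<dots> = (\<Sum>k\<le>p. if k \<le> i then a k * x (i - k) else 0)"
    by (subst sum.inter_restrict) auto
  finally show ?thesis .
qed

lemma ell2_tendsto_0: "x \<in> ell2 \<Longrightarrow> x \<longlonglongrightarrow> 0"
proof -
  assume "x \<in> ell2"
  hence "(\<lambda>i. sqrt ((cmod (x i))\<^sup>2)) \<longlonglongrightarrow> sqrt 0"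
    unfolding ell2_def by (intro tendsto_real_sqrt summable_LIMSEQ_zero) auto
  thus "x \<longlonglongrightarrow> 0" by (simp add: tendsto_norm_zero_iff)
qed

text \<open>With n = m p + r, the bound k p + j <= n is automatic for k < m, amounts to j <= r for k
  = m and fails for k > m. In this form the index fits the support of A^k v_j, which grows by p per
  step.\<close>

lemma multi_index_le_iff:
  assumes "1 \<le> j" "j \<le> p"
  shows "k < multi_index p n j \<longleftrightarrow> k * p + j \<le> n"
proof -
  have p: "p > 0" using assms by simp
  have n: "n = n div p * p + n mod p" by simp
  have m: "n mod p < p" using p by simp
  consider "k < n div p" | "k = n div p" | "k > n div p" by linarith
  thus ?thesis
  proof cases
    case 1
    hence "Suc k * p \<le> n div p * p" by (intro mult_right_mono) auto
    hence "k * p + j \<le> n" using assms n by (simp; linarith)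
    thus ?thesis using 1 by (simp add: multi_index_def)
  next
    case 2
    hence "k * p + n mod p = n" by simp
    hence "k * p + j \<le> n \<longleftrightarrow> j \<le> n mod p" by linarith
    thus ?thesis using 2 by (simp add: multi_index_def)
  next
    case 3
    hence "Suc (n div p) * p \<le> k * p" by (intro mult_right_mono) auto
    hence "n < k * p + j" using assms n m by (simp; linarith)
    thus ?thesis using 3 by (simp add: multi_index_def)
  qed
qed

lemma sum_multi_index:
  assumes "p \<ge> 1"
  shows "(\<Sum>j=1..p. multi_index p n j) = n"
proof -
  have m: "n mod p < p" using assms by simp
  have "(\<Sum>j=1..p. multi_index p n j) = (\<Sum>j=1..p. n div p + (if j \<le> n mod p then 1 else 0))"
    by (intro sum.cong) (auto simp: multi_index_def)
  also have "\<dots> = p * (n div p) + (\<Sum>j=1..p. if j \<le> n mod p then 1 else 0)"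
    by (simp add: sum.distrib)
  also have "(\<Sum>j=1..p. if j \<le> n mod p then 1 else (0::nat)) = (\<Sum>j\<in>{1..n mod p}. 1)"
    using m by (intro sum.mono_neutral_cong_right) auto
  finally show ?thesis by simp
qed

section \<open>The recurrence\<close>

locale hessenberg_toeplitz =
  fixes p :: nat
    and a :: "nat \<Rightarrow> complex"
    and Q :: "int \<Rightarrow> complex poly"
    and z :: "nat \<Rightarrow> complex \<Rightarrow> complex"
  assumes p_pos: "p \<ge> 1"
    and a_p_nonzero: "a p \<noteq> 0"
    and Q_seq: "Q_sequence p a Q"
    and solutions: "ordered_solutions p a z"
begin

abbreviation q :: "int \<Rightarrow> complex \<Rightarrow> complex" where
  "q n l \<equiv> poly (Q n) l"

text \<open>Bounds the polynomial part of the symbol on the closed unit disc.\<close>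

definition A :: real where
  "A = (\<Sum>k\<le>p. cmod (a k))"

text \<open>For \<open>w = z\<^sub>0(l)\<close> these are the coefficients of the power series of
  \<open>1 / \<Prod>\<^sub>i\<^sub>\<ge>\<^sub>1 (1 - t / z\<^sub>i(l))\<close>.\<close>

definition h :: "complex \<Rightarrow> complex \<Rightarrow> int \<Rightarrow> complex" where
  "h l w n = q n l - q (n - 1) l / w"

lemma A_nonneg: "A \<ge> 0"
  by (simp add: A_def sum_nonneg)

lemma Q_0: "Q 0 = 1"
  using Q_seq by (simp add: Q_sequence_def)

lemma Q_neg:
  assumes "- int p \<le> n" "n < 0"
  shows "Q n = 0"
proof -
  have "Q (- (- n)) = 0"
    using Q_seq assms unfolding Q_sequence_def by (metis add.inverse_inverse neg_le_iff_le zless_imp_add1_zle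
      add.commute add_0 neg_less_0_iff_less)
  thus ?thesis by simp
qed

lemma Q_rec:
  assumes "n \<ge> 0"
  shows "[:0, 1:] * Q n = Q (n + 1) + (\<Sum>k\<le>p. smult (a k) (Q (n - int k)))"
  using Q_seq assms by (simp add: Q_sequence_def)

lemma q_rec:
  assumes "n \<ge> 0"
  shows "l * q n l = q (n + 1) l + (\<Sum>k\<le>p. a k * q (n - int k) l)"
  using arg_cong[OF Q_rec[OF assms], of "\<lambda>P. poly P l"] by (simp add: poly_sum)

lemma degree_Q: "degree (Q (int n)) = n \<and> lead_coeff (Q (int n)) = 1"
proof (induction n rule: less_induct)
  case (less n)
  show ?case
  proof (cases n)
    case 0
    thus ?thesis by (simp add: Q_0)
  next
    case (Suc m)
    have eq: "Q (int n) = pCons 0 (Q (int m)) - (\<Sum>k\<le>p. smult (a k) (Q (int m - int k)))"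
      using Q_rec[of "int m"] Suc by (simp add: add.commute)
    have m: "degree (Q (int m)) = m" "coeff (Q (int m)) m = 1"
      using less.IH[of m] Suc by auto
    have lead: "degree (pCons 0 (Q (int m))) = n" "lead_coeff (pCons 0 (Q (int m))) = 1"
      using m Suc by (auto simp: coeff_pCons)
    have "degree (Q (int m - int k)) < n" if "k \<le> p" for k
    proof (cases "k \<le> m")
      case True
      thus ?thesis
        using less.IH[of "m - k"] Suc by (simp add: of_nat_diff)
    next
      case False
      hence "Q (int m - int k) = 0" using that by (intro Q_neg) auto
      thus ?thesis using Suc by simp
    qed
    hence "degree (\<Sum>k\<le>p. smult (a k) (Q (int m - int k))) < n"
      using Suc by (intro degree_sum_less) (auto intro: le_less_trans[OF degree_smult_le])
    moreover define R where "R = (\<Sum>k\<le>p. smult (a k) (Q (int m - int k)))"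
    moreover define P where "P = pCons 0 (Q (int m))"
    ultimately have eq: "Q (int n) = P + (- R)" and R: "degree (- R) < degree P" "coeff R (degree P) = 0"
        and P: "degree P = n" "lead_coeff P = 1"
      using lead eq by (auto simp: coeff_eq_0)
    show ?thesis
      using P R degree_add_eq_left[OF R(1)] by (simp add: eq)
  qed
qed

text \<open>Neighbouring terms cancel because w h_n = w q_n - q_(n-1). This is pure algebra and
  holds for every integer n, negative ones included.\<close>

lemma telescope:
  assumes "w \<noteq> 0"
  shows "q n l * w ^ j - q (n - int j) l = (\<Sum>i<j. w ^ (j - i) * h l w (n - int i))"
proof (induction j)
  case (Suc j)
  have "(\<Sum>i<Suc j. w ^ (Suc j - i) * h l w (n - int i)) =
      w * (\<Sum>i<j. w ^ (j - i) * h l w (n - int i)) + w * h l w (n - int j)"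
    by (simp add: sum_distrib_left Suc_diff_le mult.assoc)
  also have "\<dots> = w * (q n l * w ^ j - q (n - int j) l) + (w * q (n - int j) l - q (n - int j - 1) l)"
    using assms Suc by (simp add: h_def right_diff_distrib)
  finally show ?case by (simp add: algebra_simps)
qed simp

lemma h_0: "h l w 0 = 1"
  using p_pos Q_neg[of "-1"] by (simp add: h_def Q_0)

lemma h_neg:
  assumes "- int p < n" "n < 0"
  shows "h l w n = 0"
  using assms Q_neg[of n] Q_neg[of "n - 1"] by (simp add: h_def)

text \<open>In the recurrence at n - 1, writing l as 1/w plus the polynomial part of the symbol
  turns q_n - q_(n-1)/w into the sum of a_k (q_(n-1) w^k - q_(n-1-k)), which telescopes. As i < k <=
  p, each term has a factor w and an index between n - p and n - 1.\<close>

lemma h_rec: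
  assumes w: "w \<noteq> 0" "symbol p a w = l" and n: "n \<ge> 1"
  shows "h l w n = (\<Sum>k\<le>p. a k * (\<Sum>i<k. w ^ (k - i) * h l w (n - 1 - int i)))"
proof -
  have "(\<Sum>k\<le>p. a k * (\<Sum>i<k. w ^ (k - i) * h l w (n - 1 - int i))) =
      (\<Sum>k\<le>p. a k * (q (n - 1) l * w ^ k - q (n - 1 - int k) l))"
    by (simp add: telescope[OF w(1)])
  also have "\<dots> = q (n - 1) l * (\<Sum>k\<le>p. a k * w ^ k) - (\<Sum>k\<le>p. a k * q (n - 1 - int k) l)"
    by (simp add: sum_subtractf sum_distrib_left algebra_simps)
  also have "(\<Sum>k\<le>p. a k * w ^ k) = l - 1 / w"
    using w by (simp add: symbol_def inverse_eq_divide eq_diff_eq add.commute)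
  also have "(\<Sum>k\<le>p. a k * q (n - 1 - int k) l) = l * q (n - 1) l - q n l"
    using q_rec[of "n - 1" l] n by simp
  finally show ?thesis by (simp add: h_def algebra_simps)
qed

text \<open>Each term of \<open>h_rec\<close> is at most |w| \<theta>^(n-p) by induction, so the
  whole sum is at most A p |w| \<theta>^(n-p). The smallness of w makes up for the p lost powers of
  \<theta>.\<close>

lemma h_geometric_bound:
  assumes w: "w \<noteq> 0" "symbol p a w = l" "cmod w \<le> 1"
    and \<theta>: "0 < \<theta>" "\<theta> \<le> 1" "A * real p * cmod w \<le> \<theta> ^ p"
  shows "cmod (h l w (int n)) \<le> \<theta> ^ n"
proof (induction n rule: less_induct)
  case (less n)
  show ?case
  proof (cases "n = 0")
    case True
    thus ?thesis by (simp add: h_0)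
  next
    case False
    \<comment> \<open>Integer exponents let the induction hypothesis include the indices between -p
      and 0, where \<open>h\<close> vanishes.\<close>
    have *: "cmod (h l w m) \<le> \<theta> powi m" if "- int p < m" "m < int n" for m
    proof (cases "m < 0")
      case True
      thus ?thesis using that \<theta> by (simp add: h_neg)
    next
      case False
      thus ?thesis using less[of "nat m"] that by (simp add: power_int_def)
    qed
    have summand: "cmod (w ^ (k - i) * h l w (int n - 1 - int i)) \<le> cmod w * \<theta> powi (int n - int p)"
      if "k \<le> p" "i < k" for k i
    proof -
      have "cmod w ^ (k - i) \<le> cmod w ^ 1"
        using w that by (intro power_decreasing) auto
      moreover have "cmod (h l w (int n - 1 - int i)) \<le> \<theta> powi (int n - 1 - int i)"
        using that False by (intro *) auto
      moreover have "\<theta> powi (int n - 1 - int i) \<le> \<theta> powi (int n - int p)"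
        using that \<theta> by (intro power_int_decreasing) auto
      ultimately show ?thesis
        unfolding norm_mult norm_power by (intro mult_mono) auto
    qed
    have "cmod (h l w (int n)) \<le>
        (\<Sum>k\<le>p. cmod (a k) * (\<Sum>i<k. cmod (w ^ (k - i) * h l w (int n - 1 - int i))))"
      using False by (subst h_rec[OF w(1,2)])
        (auto intro!: sum_norm_le mult_left_mono norm_sum simp: norm_mult[of "a _"])
    also have "\<dots> \<le> (\<Sum>k\<le>p. cmod (a k) * (real p * (cmod w * \<theta> powi (int n - int p))))"
    proof (intro sum_mono mult_left_mono)
      fix k assume "k \<in> {..p}"
      hence "(\<Sum>i<k. cmod (w ^ (k - i) * h l w (int n - 1 - int i)))
          \<le> (\<Sum>i<k. cmod w * \<theta> powi (int n - int p))"
        using summand by (intro sum_mono) auto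
      also have "\<dots> = real k * (cmod w * \<theta> powi (int n - int p))"
        by simp
      also have "\<dots> \<le> real p * (cmod w * \<theta> powi (int n - int p))"
        using \<open>k \<in> {..p}\<close> \<theta> by (intro mult_right_mono) auto
      finally show "(\<Sum>i<k. cmod (w ^ (k - i) * h l w (int n - 1 - int i)))
          \<le> real p * (cmod w * \<theta> powi (int n - int p))" .
    qed auto
    also have "\<dots> = (A * real p * cmod w) * \<theta> powi (int n - int p)"
      by (simp add: A_def sum_distrib_right sum_distrib_left mult_ac)
    also have "\<dots> \<le> \<theta> ^ p * \<theta> powi (int n - int p)"
      using \<theta> by (intro mult_right_mono) auto
    also have "\<dots> = \<theta> ^ n"
      using \<theta> by (simp add: power_int_diff)
    finally show ?thesis .
  qed
qed

text \<open>This exhibits w^n q_n as a partial sum of the generating function of \<open>h\<close> at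
  w, which is how q_n is bounded from below.\<close>

lemma telescope_h:
  assumes "w \<noteq> 0"
  shows "w ^ n * q (int n) l = (\<Sum>i\<le>n. w ^ i * h l w (int i))"
proof (induction n)
  case 0
  show ?case by (simp add: h_0 Q_0)
next
  case (Suc n)
  have "w ^ Suc n * q (int (Suc n)) l = w ^ n * q (int n) l + w ^ Suc n * h l w (int (Suc n))"
    using assms by (simp add: h_def field_simps)
  thus ?case using Suc by simp
qed

section \<open>The solutions of the symbol equation\<close>

text \<open>This is w (a(w) - l) with the pole at 0 cleared. Its reciprocal is the generating
  function of the values Q_n(l).\<close>

definition D :: "complex \<Rightarrow> complex poly" where
  "D l = [:1, - l:] + (\<Sum>k\<le>p. monom (a k) (Suc k))"

lemma poly_D: "poly (D l) w = 1 - l * w + (\<Sum>k\<le>p. a k * w ^ Suc k)"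
  by (simp add: D_def poly_sum poly_monom mult.commute)

lemma poly_D_symbol: "w \<noteq> 0 \<Longrightarrow> poly (D l) w = w * (symbol p a w - l)"
  by (simp add: poly_D symbol_def algebra_simps sum_distrib_left)

lemma z_nonzero: "i \<le> p \<Longrightarrow> z i l \<noteq> 0"
  and z_root: "i \<le> p \<Longrightarrow> symbol p a (z i l) = l"
  and z_mult: "w \<noteq> 0 \<Longrightarrow> int (card {i. i \<le> p \<and> z i l = w}) = zorder (\<lambda>x. symbol p a x - l) w"
  and z_mono: "i < p \<Longrightarrow> cmod (z i l) \<le> cmod (z (Suc i) l)"
  using solutions unfolding ordered_solutions_def by blast+

lemma z_le:
  assumes "i \<le> j" "j \<le> p"
  shows "cmod (z i l) \<le> cmod (z j l)"
  using assms
proof (induction j rule: dec_induct)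
  case (step j)
  thus ?case using z_mono[of j l] by auto
qed simp

lemma coeff_D_top: "coeff (D l) (Suc p) = a p"
proof -
  have "coeff (D l) (Suc p) = (\<Sum>k\<le>p. if k = p then a k else 0)"
    using p_pos by (auto simp: D_def coeff_sum coeff_pCons split: nat.splits intro!: sum.cong)
  thus ?thesis by simp
qed

lemma degree_D: "degree (D l) = Suc p"
proof (rule antisym)
  show "degree (D l) \<le> Suc p"
    unfolding D_def by (intro degree_add_le degree_sum_le) (auto intro: order.trans[OF degree_monom_le])
  show "Suc p \<le> degree (D l)"
    using coeff_D_top a_p_nonzero by (intro le_degree) auto
qed

text \<open>Away from 0 the function a(x) - l is D(x)/x, and the division by x does not change the
  order of a zero there.\<close>

lemma order_D:
  assumes "w \<noteq> 0"
  shows "order w (D l) = card {i. i \<le> p \<and> z i l = w}"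
proof -
  have nz: "D l \<noteq> 0" using degree_D[of l] by auto
  obtain R where R: "D l = [:- w, 1:] ^ order w (D l) * R" "\<not> [:- w, 1:] dvd R"
    using order_decomp[OF nz] by blast
  have "zorder (\<lambda>x. symbol p a x - l) w = int (order w (D l))"
  proof (rule zorder_eqI)
    show "open (- {0::complex})" "w \<in> - {0}" using assms by auto
    show "(\<lambda>x. poly R x / x) holomorphic_on - {0}"
      by (auto intro!: holomorphic_intros)
    show "poly R w / w \<noteq> 0"
      using R(2) assms by (simp add: poly_eq_0_iff_dvd)
    fix x assume x: "x \<in> - {0}" "x \<noteq> w"
    have "symbol p a x - l = poly (D l) x / x"
      using x by (simp add: poly_D_symbol)
    also have "poly (D l) x = (x - w) ^ order w (D l) * poly R x"
      by (subst R(1)) simp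
    finally show "symbol p a x - l = poly R x / x * (x - w) powi int (order w (D l))"
      by simp
  qed
  thus ?thesis using z_mult[OF assms, of l] by simp
qed

lemma D_factor: "D l = (\<Prod>i\<le>p. [:1, - inverse (z i l):])"
proof -
  have nz: "D l \<noteq> 0" using degree_D[of l] by auto
  have "proots (D l) = image_mset (\<lambda>i. z i l) (mset_set {..p})"
  proof (rule multiset_eqI)
    fix w
    have "count (image_mset (\<lambda>i. z i l) (mset_set {..p})) w = card {i. i \<le> p \<and> z i l = w}"
      by (simp add: count_image_mset vimage_def Int_def conj_commute)
    moreover have "order w (D l) = card {i. i \<le> p \<and> z i l = w}"
    proof (cases "w = 0")
      case True
      hence "poly (D l) w \<noteq> 0" by (simp add: poly_D)
      moreover have "{i. i \<le> p \<and> z i l = w} = {}"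
        using z_nonzero True by auto
      ultimately show ?thesis by (simp add: order_0I del: Collect_empty_eq)
    qed (rule order_D)
    ultimately show "count (proots (D l)) w = count (image_mset (\<lambda>i. z i l) (mset_set {..p})) w"
      using nz by simp
  qed
  hence "D l = smult (a p) (\<Prod>i\<le>p. [:- z i l, 1:])"
    using complex_poly_decompose_multiset[of "D l"] 
    by (simp add: degree_D coeff_D_top image_mset.compositionality o_def prod_unfold_prod_mset)
  also have "(\<Prod>i\<le>p. [:- z i l, 1:]) = (\<Prod>i\<le>p. smult (- z i l) [:1, - inverse (z i l):])"
    by (intro prod.cong) (auto simp: z_nonzero)
  also have "\<dots> = smult (\<Prod>i\<le>p. - z i l) (\<Prod>i\<le>p. [:1, - inverse (z i l):])"
    by (rule prod_smult)
  finally have eq: "D l = smult (a p * (\<Prod>i\<le>p. - z i l)) (\<Prod>i\<le>p. [:1, - inverse (z i l):])"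
    by simp
  \<comment> \<open>The scalar is fixed by the constant term: both \<open>D l\<close> and the
    normalized product equal 1 at 0.\<close>
  have "a p * (\<Prod>i\<le>p. - z i l) = 1"
    using arg_cong[OF eq, of "\<lambda>P. poly P 0"] by (simp add: poly_D poly_prod)
  thus ?thesis using eq by simp
qed

section \<open>Bounds on the moduli of z_0 and z_1\<close>

lemma prod_z: "cmod (a p) * (\<Prod>i\<le>p. cmod (z i l)) = 1"
proof -
  have "lead_coeff (D l) = (\<Prod>i\<le>p. - inverse (z i l))"
    unfolding D_factor lead_coeff_prod by (intro prod.cong) (auto simp: z_nonzero)
  hence "cmod (a p) = (\<Prod>i\<le>p. inverse (cmod (z i l)))"
    by (simp add: degree_D coeff_D_top norm_inverse flip: prod_norm)
  thus ?thesis
    using z_nonzero by (simp add: prod_inversef[symmetric] o_def flip: prod.distrib)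
qed

text \<open>By \<open>prod_z\<close> this is the geometric mean of |z_0|, ..., |z_p|, which does not
  depend on l and dominates the smallest modulus.\<close>

definition M :: real where
  "M = root (Suc p) (1 / cmod (a p))"

lemma z_0_le: "cmod (z 0 l) \<le> M"
proof -
  have "cmod (z 0 l) ^ Suc p = (\<Prod>i\<le>p. cmod (z 0 l))" by simp
  also have "\<dots> \<le> (\<Prod>i\<le>p. cmod (z i l))"
    by (intro prod_mono) (auto intro: z_le)
  also have "\<dots> = 1 / cmod (a p)"
    using prod_z[of l] a_p_nonzero by (simp add: field_simps)
  finally show ?thesis
    unfolding M_def by (metis real_root_le_mono real_root_power_cancel norm_ge_zero zero_less_Suc)
qed

text \<open>Since |z_0| <= M for all l, the polynomial part of a(z_0) is bounded by C, so 1/z_0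
  differs from l by at most C, which is at most |l|/2 once |l| >= 2 C.\<close>

lemma z_0_small:
  obtains B where "B > 0" "\<And>l. cmod l \<ge> B \<Longrightarrow> cmod (z 0 l) \<le> 2 / cmod l"
proof -
  define C where "C = (\<Sum>k\<le>p. cmod (a k) * M ^ k) + 1"
  have M: "M \<ge> 0" using z_0_le[of 0] norm_ge_zero order.trans by blast
  hence C: "C > 0" unfolding C_def by (intro add_nonneg_pos sum_nonneg) auto
  show ?thesis
  proof (rule that[of "2 * C"])
    fix l assume l: "cmod l \<ge> 2 * C"
    have "l - inverse (z 0 l) = (\<Sum>k\<le>p. a k * z 0 l ^ k)"
      using z_root[of 0 l] by (auto simp: symbol_def algebra_simps)
    also have "cmod \<dots> \<le> (\<Sum>k\<le>p. cmod (a k) * M ^ k)"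
      using z_0_le by (auto intro!: sum_norm_le mult_left_mono power_mono simp: norm_mult norm_power)
    finally have "cmod l - inverse (cmod (z 0 l)) \<le> C"
      using norm_triangle_ineq2[of l "inverse (z 0 l)"] by (simp add: C_def norm_inverse)
    hence "inverse (cmod (z 0 l)) \<ge> cmod l / 2" using l by simp
    moreover have "cmod l > 0" using l C by linarith
    moreover have "cmod (z 0 l) > 0" using z_nonzero[of 0 l] by simp
    ultimately show "cmod (z 0 l) \<le> 2 / cmod l"
      by (simp add: field_simps)
  qed (use C in simp)
qed

lemma z_0_tendsto: "((\<lambda>l. z 0 l) \<longlongrightarrow> 0) at_infinity"
proof -
  obtain B where B: "B > 0" "\<And>l. cmod l \<ge> B \<Longrightarrow> cmod (z 0 l) \<le> 2 / cmod l"
    using z_0_small by blast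
  have "((\<lambda>l::complex. 2 / cmod l) \<longlongrightarrow> 0) at_infinity"
    by (intro tendsto_divide_0[OF tendsto_const] filterlim_at_top_imp_at_infinity filterlim_norm_at_top)
  thus ?thesis
    by (rule Lim_null_comparison[rotated]) (use B in \<open>auto simp: eventually_at_infinity\<close>)
qed

text \<open>Otherwise z_0 and z_1 would both be O(1/l). If they are distinct, dividing a(z_0) =
  a(z_1) by z_1 - z_0 bounds 1/(z_0 z_1), which should grow like l^2. If they coincide, the
  derivative of D vanishes there, which bounds l.\<close>

lemma z_1_large: "eventually (\<lambda>l. 2 * cmod (z 0 l) \<le> cmod (z 1 l)) at_infinity"
proof -
  obtain B where B: "B > 0" "\<And>l. cmod l \<ge> B \<Longrightarrow> cmod (z 0 l) \<le> 2 / cmod l"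
    using z_0_small by blast
  \<comment> \<open>The 4 puts both roots in the unit disc, (p + 1) A beats the derivative bound of
    the double root case, and with 8 it also gives 8 A p < |l|^2 for distinct roots.\<close>
  define C where "C = B + 4 + (real p + 1) * A + 8"
  show ?thesis unfolding eventually_at_infinity
  proof (intro exI allI impI, rule ccontr)
    fix l assume l: "C \<le> cmod l" and less: "\<not> 2 * cmod (z 0 l) \<le> cmod (z 1 l)"
    define x y where "x = z 0 l" and "y = z 1 l"
    have pA: "(real p + 1) * A \<ge> 0" using A_nonneg by simp
    have l_ge: "cmod l > B" "cmod l > 4" "cmod l > (real p + 1) * A" "cmod l \<ge> 8 + (real p + 1) * A"
      using l B(1) pA unfolding C_def by linarith+
    have nz: "x \<noteq> 0" "y \<noteq> 0" using z_nonzero p_pos by (auto simp: x_def y_def)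
    have x: "cmod x \<le> 2 / cmod l" using B l_ge by (simp add: x_def)
    hence y: "cmod y \<le> 4 / cmod l" using less by (simp add: x_def y_def)
    have l4: "4 / cmod l \<le> 1" "2 / cmod l \<le> 1"
      using l_ge(2) by (simp_all add: divide_le_eq)
    have small: "cmod x \<le> 1" "cmod y \<le> 1" using x y l4 by linarith+
    show False
    proof (cases "x = y")
      case False
      have "inverse x - inverse y = (\<Sum>k\<le>p. a k * (y ^ k - x ^ k))"
        using z_root[of 0 l] z_root[of 1 l] p_pos
        by (simp add: symbol_def x_def y_def algebra_simps sum_subtractf)
      also have "cmod \<dots> \<le> (\<Sum>k\<le>p. cmod (a k) * (real p * cmod (y - x)))"
      proof (intro sum_norm_le)
        fix k assume "k \<in> {..p}"
        have "cmod (y ^ k - x ^ k) \<le> real k * cmod (y - x)"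
          using small by (intro norm_power_diff) auto
        also have "\<dots> \<le> real p * cmod (y - x)"
          using \<open>k \<in> {..p}\<close> by (intro mult_right_mono) auto
        finally show "cmod (a k * (y ^ k - x ^ k)) \<le> cmod (a k) * (real p * cmod (y - x))"
          by (simp add: norm_mult mult_left_mono)
      qed
      also have "\<dots> = A * real p * cmod (y - x)"
        by (simp add: A_def sum_distrib_right sum_distrib_left mult_ac)
      finally have "cmod (y - x) \<le> cmod (x * y) * (A * real p) * cmod (y - x)"
        using nz by (simp add: field_simps norm_divide norm_mult)
      hence "1 \<le> cmod (x * y) * (A * real p)"
        using False by simp
      also have "\<dots> \<le> (2 / cmod l) * (4 / cmod l) * (A * real p)"
        unfolding norm_mult using x y A_nonneg by (intro mult_mono mult_right_mono) auto
      also have "\<dots> = 8 * (A * real p) / (cmod l * cmod l)"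
        by simp
      finally have "1 \<le> 8 * (A * real p) / (cmod l * cmod l)" .
      moreover have "0 < cmod l * cmod l"
        using l_ge(2) by (intro mult_pos_pos) auto
      ultimately have "cmod l * cmod l \<le> 8 * (A * real p)"
        by (simp only: pos_le_divide_eq mult_1)
      moreover have "8 * (A * real p) < cmod l * cmod l"
      proof -
        have "A * real p \<le> (real p + 1) * A" using A_nonneg by (simp add: algebra_simps)
        hence "A * real p < cmod l" using l_ge by linarith
        moreover have "8 \<le> cmod l" using l_ge pA by linarith
        moreover have "0 \<le> A * real p" using A_nonneg by simp
        ultimately show ?thesis using l_ge by (intro mult_le_less_imp_less) auto
      qed
      ultimately show False by simp
    next
      case True
      have "{0, 1} \<subseteq> {i. i \<le> p \<and> z i l = x}"
        using True p_pos by (auto simp: x_def y_def)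
      hence "card {0, 1::nat} \<le> card {i. i \<le> p \<and> z i l = x}"
        by (intro card_mono) auto
      hence "order x (D l) \<ge> 2" using order_D[OF nz(1), of l] by simp
      moreover have "D l \<noteq> 0" using degree_D[of l] by auto
      ultimately have "poly (pderiv (D l)) x = 0"
        using order_pderiv[of "D l" x] by (metis One_nat_def Suc_1 Suc_le_mono
          le_zero_eq not_less_eq_eq order_root poly_0 Suc_le_D old.nat.inject zero_le)
      moreover have "pderiv (D l) = [:- l:] + (\<Sum>k\<le>p. monom (of_nat (Suc k) * a k) k)"
        using higher_pderiv_sum[of 1 "\<lambda>k. monom (a k) (Suc k)" "{..p}"]
        by (simp add: D_def pderiv_add pderiv_pCons pderiv_monom)
      ultimately have "l = (\<Sum>k\<le>p. of_nat (Suc k) * a k * x ^ k)"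
        by (simp add: poly_sum poly_monom)
      also have "cmod \<dots> \<le> (\<Sum>k\<le>p. (real p + 1) * cmod (a k))"
      proof (intro sum_norm_le)
        fix k assume "k \<in> {..p}"
        have "real (Suc k) * cmod (a k) * cmod x ^ k \<le> (real p + 1) * cmod (a k) * 1"
          using \<open>k \<in> {..p}\<close> small by (intro mult_mono power_le_one) auto
        thus "cmod (of_nat (Suc k) * a k * x ^ k) \<le> (real p + 1) * cmod (a k)"
          by (simp add: norm_mult norm_power del: of_nat_Suc)
      qed
      also have "\<dots> = (real p + 1) * A" by (simp add: A_def sum_distrib_left)
      finally show False using l_ge by simp
    qed
  qed
qed

section \<open>Ratio asymptotics under a modulus gap\<close>

text \<open>For n > 0 the coefficient of index n is the recurrence at n - 1. The vanishing of
  Q_(-1), ..., Q_(-p) accounts for the truncation of the shifted series.\<close>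

lemma fps_Q_times_D: "Abs_fps (\<lambda>n. q (int n) l) * fps_of_poly (D l) = 1"
proof (rule fps_ext)
  fix n
  have D: "fps_of_poly (D l) = 1 - fps_const l * fps_X + (\<Sum>k\<le>p. fps_const (a k) * fps_X ^ Suc k)"
    by (simp add: D_def fps_of_poly_add fps_of_poly_pCons fps_of_poly_sum fps_of_poly_monom del: power_Suc)
  show "fps_nth (Abs_fps (\<lambda>n. q (int n) l) * fps_of_poly (D l)) n = fps_nth 1 n"
  proof (cases n)
    case 0
    thus ?thesis by (simp add: D fps_sum_nth Q_0)
  next
    case (Suc m)
    have summand: "fps_nth (Abs_fps (\<lambda>n. q (int n) l) * (fps_const (a k) * fps_X ^ Suc k)) n
        = a k * q (int m - int k) l" if "k \<le> p" for k
    proof -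
      have "Abs_fps (\<lambda>n. q (int n) l) * (fps_const (a k) * fps_X ^ Suc k)
          = fps_const (a k) * (Abs_fps (\<lambda>n. q (int n) l) * fps_X ^ Suc k)"
        by (simp only: mult_ac)
      thus ?thesis
        using that Suc Q_neg[of "int m - int k"]
        by (simp only: fps_mult_left_const_nth fps_X_power_mult_right_nth) (auto simp: of_nat_diff)
    qed
    have "fps_nth (Abs_fps (\<lambda>n. q (int n) l) * fps_of_poly (D l)) n =
        q (int n) l - l * q (int m) l + (\<Sum>k\<le>p. a k * q (int m - int k) l)"
      using Suc summand unfolding D
      by (simp add: distrib_left right_diff_distrib sum_distrib_left fps_sum_nth mult.left_commute[of _ "fps_const l"]
          del: power_Suc)
    also have "\<dots> = 0"
      using q_rec[of "int m" l] Suc by (simp add: add.commute)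
    finally show ?thesis using Suc by simp
  qed
qed

lemma fps_h_times_prod:
  "Abs_fps (\<lambda>n. h l (z 0 l) (int n)) * (\<Prod>i\<in>{1..p}. 1 - fps_const (inverse (z i l)) * fps_X) = 1"
proof -
  have "fps_of_poly (D l) = (\<Prod>i\<le>p. 1 - fps_const (inverse (z i l)) * fps_X)"
    unfolding D_factor fps_of_poly_prod by (intro prod.cong) (auto simp: fps_of_poly_pCons)
  also have "\<dots> = (1 - fps_const (inverse (z 0 l)) * fps_X) *
      (\<Prod>i\<in>{1..p}. 1 - fps_const (inverse (z i l)) * fps_X)"
    by (simp add: atMost_atLeast0 prod.atLeast_Suc_atMost)
  finally have D: "fps_of_poly (D l) = (1 - fps_const (inverse (z 0 l)) * fps_X) *
      (\<Prod>i\<in>{1..p}. 1 - fps_const (inverse (z i l)) * fps_X)" .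
  have "Abs_fps (\<lambda>n. h l (z 0 l) (int n)) =
      Abs_fps (\<lambda>n. q (int n) l) * (1 - fps_const (inverse (z 0 l)) * fps_X)" (is "?H = ?G * _")
  proof (rule fps_ext)
    fix n
    have "?G * (1 - fps_const (inverse (z 0 l)) * fps_X) =
        ?G - fps_const (inverse (z 0 l)) * (?G * fps_X)"
      by (simp add: right_diff_distrib mult_ac)
    thus "fps_nth ?H n = fps_nth (?G * (1 - fps_const (inverse (z 0 l)) * fps_X)) n"
      using Q_neg[of "-1"] p_pos
      by (cases n) (auto simp: h_def Q_0 field_simps)
  qed
  thus ?thesis using fps_Q_times_D[of l] by (simp add: D mult.assoc)
qed

lemma z_inverse_le:
  assumes "i \<in> {1..p}"
  shows "cmod (inverse (z i l)) \<le> inverse (cmod (z 1 l))"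
  using assms z_le[of 1 i l] z_nonzero[of 1 l] p_pos
  by (auto simp: norm_inverse intro!: le_imp_inverse_le)

text \<open>The modulus gap between \<open>z\<^sub>0\<close> and \<open>z\<^sub>1\<close> is the only input of the estimates; this is what
  makes them uniform.\<close>

lemma scaled_h_bound:
  assumes "cmod (z 0 l) \<le> \<rho> * cmod (z 1 l)"
  shows "cmod (z 0 l ^ n * h l (z 0 l) (int n)) \<le> real (n + 1) ^ p * \<rho> ^ n"
proof -
  have z1: "cmod (z 1 l) > 0" using z_nonzero[of 1 l] p_pos by simp
  have "cmod (h l (z 0 l) (int n)) \<le> real (n + 1) ^ p * inverse (cmod (z 1 l)) ^ n"
    using prod_linear_inverse_coeff_le[OF _ fps_h_times_prod[of l] z_inverse_le, where n = n] by simp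
  hence "cmod (z 0 l) ^ n * cmod (h l (z 0 l) (int n)) \<le>
      (\<rho> * cmod (z 1 l)) ^ n * (real (n + 1) ^ p * inverse (cmod (z 1 l)) ^ n)"
    using assms order.trans[OF norm_ge_zero assms] by (intro mult_mono power_mono zero_le_power) auto
  also have "\<dots> = real (n + 1) ^ p * \<rho> ^ n"
    using z1 by (simp add: field_simps)
  finally show ?thesis by (simp add: norm_mult norm_power)
qed

text \<open>By \<open>telescope_h\<close> the quantity is a partial sum of a series with value s,
  the reciprocal of the product of the 1 - z_0/z_i over i >= 1. These factors have modulus at most
  2, so |s| >= 2^(-p), and the tail is eventually below half of that. The majorant \<open>b\<close>
  depends only on \<rho>, so N serves all l.\<close>

lemma scaled_q_lower_bound:
  assumes \<rho>: "0 \<le> \<rho>" "\<rho> < 1"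
  obtains N where "\<And>n l. n \<ge> N \<Longrightarrow> cmod (z 0 l) \<le> \<rho> * cmod (z 1 l) \<Longrightarrow>
     cmod (z 0 l ^ n * q (int n) l) \<ge> 1 / 2 ^ Suc p"
proof -
  define b where "b = (\<lambda>n. real (n + 1) ^ p * \<rho> ^ n)"
  have b: "summable b" unfolding b_def using \<rho> by (rule summable_poly_geometric)
  have "(\<lambda>n. \<Sum>i. b (i + n)) \<longlonglongrightarrow> 0"
    using b by (rule suminf_exist_split2)
  hence "eventually (\<lambda>n. (\<Sum>i. b (i + n)) < 1 / 2 ^ Suc p) sequentially"
    by (rule order_tendstoD) simp
  then obtain N where N: "\<And>n. n \<ge> N \<Longrightarrow> (\<Sum>i. b (i + n)) < 1 / 2 ^ Suc p"
    by (auto simp: eventually_sequentially)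
  show ?thesis
  proof (rule that[of N])
    fix n l assume n: "n \<ge> N" and l: "cmod (z 0 l) \<le> \<rho> * cmod (z 1 l)"
    define c where "c = (\<lambda>i. h l (z 0 l) (int i) * z 0 l ^ i)"
    define s where "s = inverse (\<Prod>i\<in>{1..p}. 1 - inverse (z i l) * z 0 l)"
    have z1: "cmod (z 1 l) > 0" using z_nonzero[of 1 l] p_pos by simp
    have r: "cmod (z 0 l) * inverse (cmod (z 1 l)) \<le> \<rho>"
      using l z1 by (simp add: field_simps)
    have "c sums s"
      using prod_linear_inverse_sums[OF _ fps_h_times_prod z_inverse_le, of l "z 0 l"] r \<rho>
      by (simp add: c_def s_def)
    have c_le: "cmod (c i) \<le> b i" for i
      using scaled_h_bound[OF l, of i] by (simp add: c_def b_def mult.commute)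
    have q_eq: "z 0 l ^ n * q (int n) l = (\<Sum>i<Suc n. c i)"
      using telescope_h[of "z 0 l" n l] z_nonzero[of 0 l]
      by (simp add: c_def mult.commute flip: lessThan_Suc_atMost)
    have bn: "summable (\<lambda>i. b (i + Suc n))"
      using b by (rule summable_ignore_initial_segment)
    have "s - (\<Sum>i<Suc n. c i) = (\<Sum>i. c (i + Suc n))"
      using \<open>c sums s\<close> suminf_minus_initial_segment[of c "Suc n"] by (simp add: sums_iff)
    also have "cmod \<dots> \<le> (\<Sum>i. b (i + Suc n))"
      by (intro norm_suminf_le bn c_le)
    also have "\<dots> < 1 / 2 ^ Suc p" using n by (intro N) simp
    finally have tail: "cmod (s - (\<Sum>i<Suc n. c i)) < 1 / 2 ^ Suc p" .
    have factor: "cmod (inverse (z i l) * z 0 l) \<le> \<rho>" if "i \<in> {1..p}" for i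
    proof -
      have "cmod (inverse (z i l)) * cmod (z 0 l) \<le> inverse (cmod (z 1 l)) * cmod (z 0 l)"
        using z_inverse_le[OF that] by (intro mult_right_mono) auto
      thus ?thesis using r unfolding norm_mult by (simp add: mult.commute)
    qed
    have "cmod (\<Prod>i\<in>{1..p}. 1 - inverse (z i l) * z 0 l) \<le> (\<Prod>i\<in>{1..p}. 2)"
      unfolding prod_norm[symmetric]
    proof (intro prod_mono conjI)
      fix i assume "i \<in> {1..p}"
      thus "cmod (1 - inverse (z i l) * z 0 l) \<le> 2"
        using norm_triangle_ineq4[of 1 "inverse (z i l) * z 0 l"] factor[of i] \<rho> by simp
    qed auto
    moreover have "1 - inverse (z i l) * z 0 l \<noteq> 0" if "i \<in> {1..p}" for i
      using factor[OF that] \<rho> by auto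
    hence "(\<Prod>i\<in>{1..p}. 1 - inverse (z i l) * z 0 l) \<noteq> 0" by simp
    ultimately have "cmod s \<ge> 1 / 2 ^ p"
      unfolding s_def norm_inverse by (simp add: field_simps)
    moreover have "cmod s \<le> cmod (s - (\<Sum>i<Suc n. c i)) + cmod (\<Sum>i<Suc n. c i)"
      using norm_triangle_ineq[of "s - (\<Sum>i<Suc n. c i)" "\<Sum>i<Suc n. c i"] by simp
    ultimately have "1 / 2 ^ p - 1 / 2 ^ Suc p \<le> cmod (\<Sum>i<Suc n. c i)"
      using tail by linarith
    thus "cmod (z 0 l ^ n * q (int n) l) \<ge> 1 / 2 ^ Suc p"
      unfolding q_eq by (simp add: field_simps)
  qed
qed

lemma M_nonneg: "M \<ge> 0"
  using z_0_le[of 0] norm_ge_zero order.trans by blast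

text \<open>After multiplication by z_0^n the telescoped remainder consists of terms z_0^j
  (z_0^(n-i) h_(n-i)), each at most M^j b(n-i), while z_0^n q_n is bounded below. The error
  \<open>e\<close> is independent of l.\<close>

lemma ratio_error_bound:
  assumes \<rho>: "0 \<le> \<rho>" "\<rho> < 1"
  obtains N e where "e \<longlonglongrightarrow> (0::real)"
    and "\<And>n l. n \<ge> N \<Longrightarrow> cmod (z 0 l) \<le> \<rho> * cmod (z 1 l) \<Longrightarrow> q (int n) l \<noteq> 0 \<and>
     cmod (q (int n - int j) l / q (int n) l - z 0 l ^ j) \<le> e n"
proof -
  define b where "b = (\<lambda>n. real (n + 1) ^ p * \<rho> ^ n)"
  have "b \<longlonglongrightarrow> 0" unfolding b_def
    by (intro summable_LIMSEQ_zero summable_poly_geometric \<rho>)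
  obtain N where N: "\<And>n l. n \<ge> N \<Longrightarrow> cmod (z 0 l) \<le> \<rho> * cmod (z 1 l) \<Longrightarrow>
     cmod (z 0 l ^ n * q (int n) l) \<ge> 1 / 2 ^ Suc p"
    using scaled_q_lower_bound[OF \<rho>] by blast
  define e where "e = (\<lambda>n. M ^ j * (\<Sum>i<j. b (n - i)) * 2 ^ Suc p)"
  have "(\<lambda>n. b (n - i)) \<longlonglongrightarrow> 0" for i
    by (rule filterlim_compose[OF \<open>b \<longlonglongrightarrow> 0\<close>]) (rule filterlim_minus_const_nat_at_top)
  hence "e \<longlonglongrightarrow> M ^ j * (\<Sum>i<j. 0) * 2 ^ Suc p"
    unfolding e_def by (intro tendsto_intros)
  hence "e \<longlonglongrightarrow> 0" by simp
  moreover have "q (int n) l \<noteq> 0 \<and> cmod (q (int n - int j) l / q (int n) l - z 0 l ^ j) \<le> e n"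
    if n: "n \<ge> N + j" and l: "cmod (z 0 l) \<le> \<rho> * cmod (z 1 l)" for n l
  proof
    define w where "w = z 0 l"
    have w: "w \<noteq> 0" using z_nonzero[of 0 l] by (simp add: w_def)
    have lower: "cmod (w ^ n * q (int n) l) \<ge> 1 / 2 ^ Suc p"
      using N n l by (simp add: w_def)
    have "(0::real) < 1 / 2 ^ Suc p" by simp
    hence "w ^ n * q (int n) l \<noteq> 0" using lower by (metis norm_zero not_less)
    thus nz: "q (int n) l \<noteq> 0" by simp
    have "w ^ j - q (int n - int j) l / q (int n) l =
        w ^ n * (q (int n) l * w ^ j - q (int n - int j) l) / (w ^ n * q (int n) l)"
      using w nz by (simp add: field_simps)
    also have "w ^ n * (q (int n) l * w ^ j - q (int n - int j) l) =
        (\<Sum>i<j. w ^ n * (w ^ (j - i) * h l w (int n - int i)))"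
      by (simp add: telescope[OF w] sum_distrib_left)
    also have "\<dots> = (\<Sum>i<j. w ^ j * (w ^ (n - i) * h l w (int (n - i))))"
    proof (intro sum.cong refl)
      fix i assume "i \<in> {..<j}"
      hence i: "i < j" "i \<le> n" using n by auto
      hence "w ^ n * w ^ (j - i) = w ^ j * w ^ (n - i)"
        by (simp add: add.commute flip: power_add)
      thus "w ^ n * (w ^ (j - i) * h l w (int n - int i)) = w ^ j * (w ^ (n - i) * h l w (int (n - i)))"
        using i by (simp add: of_nat_diff mult.assoc[symmetric])
    qed
    finally have "cmod (w ^ j - q (int n - int j) l / q (int n) l) =
        cmod (\<Sum>i<j. w ^ j * (w ^ (n - i) * h l w (int (n - i)))) / cmod (w ^ n * q (int n) l)"
      by (simp add: norm_divide)
    also have "\<dots> \<le> (\<Sum>i<j. M ^ j * b (n - i)) / (1 / 2 ^ Suc p)"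
    proof (intro frac_le lower sum_norm_le)
      fix i
      show "cmod (w ^ j * (w ^ (n - i) * h l w (int (n - i)))) \<le> M ^ j * b (n - i)"
        using scaled_h_bound[OF l, of "n - i"] z_0_le[of l] M_nonneg
        unfolding w_def b_def
        by (subst norm_mult, subst norm_power, intro mult_mono power_mono) auto
    qed (auto intro!: sum_nonneg mult_nonneg_nonneg simp: M_nonneg b_def \<rho>)
    also have "\<dots> = e n" by (simp add: e_def sum_distrib_left)
    finally show "cmod (q (int n - int j) l / q (int n) l - z 0 l ^ j) \<le> e n"
      by (simp add: w_def norm_minus_commute)
  qed
  ultimately show ?thesis using that by blast
qed

section \<open>The modulus gap on compact sets\<close>

text \<open>Either |z_i| > 1, or the symbol equation is solved for 1/z_i with the polynomial part
  bounded by \<open>A\<close>.\<close>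

lemma inverse_z_bound:
  assumes "i \<le> p"
  shows "cmod (inverse (z i l)) \<le> 1 + cmod l + A"
proof (cases "cmod (z i l) \<le> 1")
  case False
  hence "cmod (inverse (z i l)) \<le> 1"
    by (simp add: norm_inverse inverse_le_1_iff)
  thus ?thesis using A_nonneg by (smt (verit) norm_ge_zero)
next
  case True
  have "inverse (z i l) = l - (\<Sum>k\<le>p. a k * z i l ^ k)"
    using z_root[OF assms, of l] by (auto simp: symbol_def algebra_simps)
  also have "cmod \<dots> \<le> cmod l + cmod (\<Sum>k\<le>p. a k * z i l ^ k)"
    by (rule norm_triangle_ineq4)
  also have "cmod (\<Sum>k\<le>p. a k * z i l ^ k) \<le> A"
    unfolding A_def
    using True by (intro sum_norm_le) (auto simp: norm_mult norm_power intro!: mult_left_le power_le_one)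
  finally show ?thesis by simp
qed

text \<open>If no \<rho> works, points of K with |z_0|/|z_1| tending to 1 accumulate at some l in K.
  The single z_i may be discontinuous, but the coefficients of D depend continuously on l, so the
  multiset of inverse roots passes to the limit, and ordering by modulus then gives |z_0(l)| =
  |z_1(l)|.\<close>

lemma modulus_gap_compact:
  assumes K: "compact K" "K \<inter> Gamma1 z = {}"
  obtains \<rho> where "0 \<le> \<rho>" "\<rho> < 1" "\<And>l. l \<in> K \<Longrightarrow> cmod (z 0 l) \<le> \<rho> * cmod (z 1 l)"
proof (rule ccontr)
  assume "\<not> thesis"
  hence "\<exists>l\<in>K. \<not> cmod (z 0 l) \<le> (1 - inverse (real (Suc n))) * cmod (z 1 l)" for n
    using that[of "1 - inverse (real (Suc n))"] by (force simp: inverse_le_1_iff)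
  then obtain L where L: "\<And>n. L n \<in> K"
      "\<And>n. cmod (z 0 (L n)) > (1 - inverse (real (Suc n))) * cmod (z 1 (L n))"
    unfolding not_le by metis
  obtain l s where s: "l \<in> K" "strict_mono (s :: nat \<Rightarrow> nat)" "(L \<circ> s) \<longlonglongrightarrow> l"
    using K L unfolding compact_def by metis
  obtain B where B: "\<And>x. x \<in> K \<Longrightarrow> cmod x \<le> B"
    using compact_imp_bounded[OF K(1)] unfolding bounded_iff by blast
  have "bounded (range (\<lambda>n. inverse (z i (L (s n)))))" if "i \<in> {..p}" for i
    using inverse_z_bound[of i] B[OF L(1)] that
    unfolding bounded_iff by (intro exI[of _ "1 + B + A"]) (force intro: order.trans)
  then obtain r v where r: "strict_mono (r :: nat \<Rightarrow> nat)"
    and v: "\<And>i. i \<in> {..p} \<Longrightarrow> ((\<lambda>n. inverse (z i (L (s n)))) \<circ> r) \<longlonglongrightarrow> v i"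
    using bounded_family_convergent_subseq[of "{..p}" "\<lambda>i n. inverse (z i (L (s n)))"] by blast
  define t where "t = s \<circ> r"
  have t: "strict_mono t" unfolding t_def using s r by (intro strict_mono_o)
  have lim: "(\<lambda>n. inverse (z i (L (t n)))) \<longlonglongrightarrow> v i" if "i \<le> p" for i
    using v[of i] that by (simp add: o_def t_def)
  have limL: "(\<lambda>n. L (t n)) \<longlonglongrightarrow> l"
    using LIMSEQ_subseq_LIMSEQ[OF s(3) r] by (simp add: o_def t_def)
  have factor: "(\<Prod>i\<le>p. 1 - inverse (z i l) * x) = poly (D l) x" for l x
    unfolding D_factor by (simp add: poly_prod mult.commute)
  have "(\<Prod>i\<le>p. 1 - v i * x) = (\<Prod>i\<le>p. 1 - inverse (z i l) * x)" for x
  proof (rule LIMSEQ_unique)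
    show "(\<lambda>n. \<Prod>i\<le>p. 1 - inverse (z i (L (t n))) * x) \<longlonglongrightarrow> (\<Prod>i\<le>p. 1 - v i * x)"
      by (intro tendsto_intros lim) auto
    show "(\<lambda>n. \<Prod>i\<le>p. 1 - inverse (z i (L (t n))) * x) \<longlonglongrightarrow> (\<Prod>i\<le>p. 1 - inverse (z i l) * x)"
      unfolding factor poly_D by (intro tendsto_intros limL)
  qed
  hence "image_mset v (mset_set {..p}) = image_mset (\<lambda>i. inverse (z i l)) (mset_set {..p})"
    by (rule prod_linear_roots_unique)
  from arg_cong[OF this, of "image_mset cmod"]
  have mset_eq: "image_mset (\<lambda>i. cmod (v i)) (mset_set {..p}) =
      image_mset (\<lambda>i. cmod (inverse (z i l))) (mset_set {..p})"
    by (simp add: image_mset.compositionality o_def)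
  have anti: "cmod (inverse (z (Suc i) l)) \<le> cmod (inverse (z i l))" if "i < p" for i l
    using z_mono[OF that, of l] z_nonzero[of i l] that
    by (auto simp: norm_inverse intro!: le_imp_inverse_le)
  have antiv: "cmod (v (Suc i)) \<le> cmod (v i)" if "i < p" for i
    using that by (intro LIMSEQ_le[OF tendsto_norm[OF lim] tendsto_norm[OF lim]])
      (auto intro!: anti)
  have "cmod (v i) = cmod (inverse (z i l))" if "i \<le> p" for i
    using antimono_image_mset_eq[OF mset_eq] antiv anti that by blast
  \<comment> \<open>The violated gap is rewritten for inverse roots, which reverses the order; its
    factor 1 - 1/(n + 1) tends to 1.\<close>
  moreover have "cmod (v 0) \<le> cmod (v 1)"
  proof (rule LIMSEQ_le)
    have *: "(\<lambda>n. 1 - inverse (real (Suc (t n)))) \<longlonglongrightarrow> 1 - 0"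
      using LIMSEQ_subseq_LIMSEQ[OF LIMSEQ_inverse_real_of_nat t]
      by (intro tendsto_intros) (simp add: o_def)
    show "(\<lambda>n. (1 - inverse (real (Suc (t n)))) * cmod (inverse (z 0 (L (t n))))) \<longlonglongrightarrow> cmod (v 0)"
      using tendsto_mult[OF * tendsto_norm[OF lim[of 0]]] by simp
    show "(\<lambda>n. cmod (inverse (z 1 (L (t n))))) \<longlonglongrightarrow> cmod (v 1)"
      using p_pos by (intro tendsto_norm lim) auto
    have "(1 - inverse (real (Suc (t n)))) * cmod (inverse (z 0 (L (t n)))) \<le> cmod (inverse (z 1 (L (t n))))" for n
    proof -
      have "(1 - inverse (real (Suc (t n)))) * cmod (z 1 (L (t n))) \<le> cmod (z 0 (L (t n)))"
        using L(2)[of "t n"] by simp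
      moreover have "cmod (z 0 (L (t n))) > 0" "cmod (z 1 (L (t n))) > 0"
        using z_nonzero[of 0 "L (t n)"] z_nonzero[of 1 "L (t n)"] p_pos by simp_all
      ultimately show ?thesis
        unfolding norm_inverse inverse_eq_divide[of "cmod _"] times_divide_eq_right mult_1_right
        by (subst frac_le_eq) (auto simp: divide_le_eq mult_ac zero_less_mult_iff)
    qed
    thus "\<exists>N. \<forall>n\<ge>N. (1 - inverse (real (Suc (t n)))) * cmod (inverse (z 0 (L (t n)))) \<le> cmod (inverse (z 1 (L (t n))))"
      by blast
  qed
  moreover have "cmod (v 1) \<le> cmod (v 0)" using antiv[of 0] p_pos by simp
  ultimately have "cmod (inverse (z 0 l)) = cmod (inverse (z 1 l))"
    using p_pos by (metis order_antisym le0)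
  hence "l \<in> Gamma1 z" by (simp add: Gamma1_def norm_inverse)
  thus False using s K by blast
qed

text \<open>Outside a large disc \<open>z_1_large\<close> gives the ratio 1/2. Inside it, K is
  closed in the sphere by the Hausdorff property, so its trace on the disc is compact.\<close>

lemma modulus_gap_sphere:
  assumes K: "compactin riemann_sphere K" "K \<inter> Some ` Gamma1 z = {}"
  obtains \<rho> where "0 \<le> \<rho>" "\<rho> < 1" "\<And>l. Some l \<in> K \<Longrightarrow> cmod (z 0 l) \<le> \<rho> * cmod (z 1 l)"
proof -
  obtain B where B: "\<And>l. cmod l \<ge> B \<Longrightarrow> 2 * cmod (z 0 l) \<le> cmod (z 1 l)"
    using z_1_large unfolding eventually_at_infinity by blast
  have "Hausdorff_space riemann_sphere"
    by (simp add: Hausdorff_space_Alexandroff_compactification locally_compact_space_euclidean)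
  hence "closedin riemann_sphere K"
    using K(1) by (intro compactin_imp_closedin)
  hence "closedin euclidean {l \<in> topspace euclidean. Some l \<in> K}"
    by (rule closedin_continuous_map_preimage[OF continuous_map_Some])
  hence "closed {l. Some l \<in> K}" by simp
  hence "compact ({l. Some l \<in> K} \<inter> cball 0 B)"
    by (rule closed_Int_compact) simp
  moreover have "({l. Some l \<in> K} \<inter> cball 0 B) \<inter> Gamma1 z = {}"
    using K(2) by auto
  ultimately obtain \<rho> where \<rho>: "0 \<le> \<rho>" "\<rho> < 1"
    "\<And>l. l \<in> {l. Some l \<in> K} \<inter> cball 0 B \<Longrightarrow> cmod (z 0 l) \<le> \<rho> * cmod (z 1 l)"
    using modulus_gap_compact by blast
  show ?thesis
  proof (rule that[of "max \<rho> (1/2)"])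
    fix l assume l: "Some l \<in> K"
    have max: "\<rho> * cmod (z 1 l) \<le> max \<rho> (1/2) * cmod (z 1 l)" "(1/2) * cmod (z 1 l) \<le> max \<rho> (1/2) * cmod (z 1 l)"
      by (intro mult_right_mono, simp, simp)+
    show "cmod (z 0 l) \<le> max \<rho> (1/2) * cmod (z 1 l)"
    proof (cases "cmod l \<le> B")
      case True
      thus ?thesis using \<rho>(3)[of l] l max(1) by simp
    next
      case False
      thus ?thesis using B[of l] max(2) by simp
    qed
  qed (use \<rho> in auto)
qed

section \<open>Uniform convergence of the ratios on compact subsets of the sphere\<close>

lemma Q_ratio_tendsto_0:
  assumes "j \<ge> 1" "n \<ge> j"
  shows "((\<lambda>l. q (int n - int j) l / q (int n) l) \<longlongrightarrow> 0) at_infinity"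
proof -
  have "degree (Q (int n - int j)) < degree (Q (int n))"
    using degree_Q[of n] degree_Q[of "n - j"] assms by (simp add: of_nat_diff)
  thus ?thesis by (rule poly_divide_tendsto_0_at_infinity)
qed

lemma uniform_ratio_convergence:
  assumes "j \<in> {1..p}" and K: "compactin riemann_sphere K" "K \<inter> Some ` Gamma1 z = {}"
  shows "(\<forall>\<^sub>F n in sequentially. \<forall>l. Some l \<in> K \<longrightarrow> q (int n) l \<noteq> 0) \<and>
        uniform_limit K
          (\<lambda>n. sphere_ext (\<lambda>l. q (int n - int j) l / q (int n) l))
          (sphere_ext (\<lambda>l. z 0 l ^ j)) sequentially"
proof -
  obtain \<rho> where \<rho>: "0 \<le> \<rho>" "\<rho> < 1" "\<And>l. Some l \<in> K \<Longrightarrow> cmod (z 0 l) \<le> \<rho> * cmod (z 1 l)"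
    using modulus_gap_sphere[OF K] by blast
  obtain N e where e: "e \<longlonglongrightarrow> (0::real)"
    "\<And>n l. n \<ge> N \<Longrightarrow> cmod (z 0 l) \<le> \<rho> * cmod (z 1 l) \<Longrightarrow> q (int n) l \<noteq> 0 \<and>
     cmod (q (int n - int j) l / q (int n) l - z 0 l ^ j) \<le> e n"
    by (rule ratio_error_bound[OF \<rho>(1,2), where j = j]) (rule that)
  have "uniform_limit K
          (\<lambda>n. sphere_ext (\<lambda>l. q (int n - int j) l / q (int n) l))
          (sphere_ext (\<lambda>l. z 0 l ^ j)) sequentially"
  proof (rule uniform_limitI)
    fix \<epsilon> :: real assume \<epsilon>: "\<epsilon> > 0"
    \<comment> \<open>The error bound handles finite points; n >= j is for the point at infinity,
      where the ratio vanishes by comparison of degrees.\<close>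
    have "eventually (\<lambda>n. e n < \<epsilon> \<and> n \<ge> N \<and> n \<ge> j) sequentially"
      using order_tendstoD(2)[OF e(1) \<epsilon>] eventually_ge_at_top[of N] eventually_ge_at_top[of j]
      by eventually_elim simp
    thus "\<forall>\<^sub>F n in sequentially. \<forall>x\<in>K. dist (sphere_ext (\<lambda>l. q (int n - int j) l / q (int n) l) x)
          (sphere_ext (\<lambda>l. z 0 l ^ j) x) < \<epsilon>"
    proof eventually_elim
      case (elim n)
      show ?case
      proof
        fix x assume x: "x \<in> K"
        show "dist (sphere_ext (\<lambda>l. q (int n - int j) l / q (int n) l) x)
          (sphere_ext (\<lambda>l. z 0 l ^ j) x) < \<epsilon>"
        proof (cases x)
          case (Some l)
          thus ?thesis using e(2)[of n l] \<rho>(3)[of l] x elim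
            by (auto simp: sphere_ext_def dist_norm)
        next
          case None
          have "((\<lambda>l. z 0 l ^ j) \<longlongrightarrow> 0 ^ j) at_infinity"
            by (intro tendsto_power z_0_tendsto)
          hence "((\<lambda>l. z 0 l ^ j) \<longlongrightarrow> 0) at_infinity"
            using assms(1) by (simp add: power_0_left split: if_splits)
          hence "Lim at_infinity (\<lambda>l. z 0 l ^ j) = 0"
            by (intro tendsto_Lim trivial_limit_at_infinity)
          moreover have "Lim at_infinity (\<lambda>l. q (int n - int j) l / q (int n) l) = 0"
            using assms(1) elim by (intro tendsto_Lim trivial_limit_at_infinity Q_ratio_tendsto_0) auto
          ultimately show ?thesis using None \<epsilon> by (simp add: sphere_ext_def)
        qed
      qed
    qed
  qed
  moreover have "\<forall>\<^sub>F n in sequentially. \<forall>l. Some l \<in> K \<longrightarrow> q (int n) l \<noteq> 0"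
    using eventually_ge_at_top[of N] by eventually_elim (use e(2) \<rho>(3) in blast)
  ultimately show ?thesis by blast
qed

section \<open>Orthogonality and Hermite-Pade approximation\<close>

text \<open>The entry at 0 of P(A) v. Leaving v arbitrary allows powers of A to be moved from the
  polynomial to the vector during inductions.\<close>

definition pairing :: "complex poly \<Rightarrow> (nat \<Rightarrow> complex) \<Rightarrow> complex" where
  "pairing P v = (\<Sum>n\<le>degree P. coeff P n * (mat_apply (toeplitz p a) ^^ n) v 0)"

lemma pairing_bound:
  assumes "degree P \<le> N"
  shows "pairing P v = (\<Sum>n\<le>N. coeff P n * (mat_apply (toeplitz p a) ^^ n) v 0)"
  unfolding pairing_def using assms
  by (intro sum.mono_neutral_left) (auto simp: coeff_eq_0)

lemma pairing_diff: "pairing (P - R) v = pairing P v - pairing R v"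
proof -
  define N where "N = max (degree P) (degree R)"
  have "degree (P - R) \<le> N" unfolding N_def by (rule degree_diff_le_max)
  thus ?thesis
    by (simp add: pairing_bound[of _ N] N_def left_diff_distrib sum_subtractf)
qed

lemma pairing_smult: "pairing (smult c P) v = c * pairing P v"
  by (simp add: pairing_bound[OF degree_smult_le] pairing_def sum_distrib_left mult.assoc)

lemma pairing_0: "pairing 0 v = 0"
  by (simp add: pairing_def)

lemma pairing_sum: "pairing (\<Sum>i\<in>I. f i) v = (\<Sum>i\<in>I. pairing (f i) v)"
proof (induction I rule: infinite_finite_induct)
  case (insert i I)
  have "pairing (f i + sum f I) v = pairing (f i - smult (-1) (sum f I)) v" by simp
  also have "\<dots> = pairing (f i) v + pairing (sum f I) v"
    unfolding pairing_diff pairing_smult by simp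
  finally show ?case using insert by simp
qed (auto simp: pairing_0)

lemma pairing_X: "pairing (pCons 0 P) v = pairing P (mat_apply (toeplitz p a) v)"
proof -
  have "pairing (pCons 0 P) v =
      (\<Sum>n\<le>Suc (degree P). coeff (pCons 0 P) n * (mat_apply (toeplitz p a) ^^ n) v 0)"
    by (intro pairing_bound) (simp add: degree_pCons_le)
  also have "\<dots> = (\<Sum>n\<le>degree P. coeff P n * (mat_apply (toeplitz p a) ^^ Suc n) v 0)"
    by (subst sum.atMost_Suc_shift) simp
  finally show ?thesis by (simp add: pairing_def funpow_Suc_right del: funpow.simps)
qed

text \<open>In matrix terms: the first row of \<open>Q\<^sub>n(A)\<close> is the \<open>n\<close>-th unit row vector.\<close>

lemma pairing_Q: "pairing (Q (int n)) v = v n"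
proof (induction n arbitrary: v rule: less_induct)
  case (less n)
  show ?case
  proof (cases n)
    case 0
    thus ?thesis by (simp add: Q_0 pairing_def)
  next
    case (Suc m)
    have eq: "Q (int n) = pCons 0 (Q (int m)) - (\<Sum>k\<le>p. smult (a k) (Q (int m - int k)))"
      using Q_rec[of "int m"] Suc by (simp add: add.commute)
    have low: "pairing (Q (int m - int k)) v = (if k \<le> m then v (m - k) else 0)" if "k \<le> p" for k
      using less[of "m - k" v] Suc that Q_neg[of "int m - int k"] by (auto simp: of_nat_diff pairing_0)
    have "pairing (Q (int n)) v = mat_apply (toeplitz p a) v m -
        (\<Sum>k\<le>p. a k * (if k \<le> m then v (m - k) else 0))"
      using less[of m] Suc low unfolding eq pairing_diff pairing_X pairing_sum pairing_smult by simp
    also have "\<dots> = v n"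
      using Suc by (simp add: mat_apply_toeplitz if_distrib[of "\<lambda>x. a _ * x"] cong: if_cong)
    finally show ?thesis .
  qed
qed

lemma pairing_monom_mult:
  "pairing (monom 1 k * P) v = pairing P ((mat_apply (toeplitz p a) ^^ k) v)"
proof (induction k arbitrary: v)
  case (Suc k)
  have "monom 1 (Suc k) * P = pCons 0 (monom 1 k * P)"
    by (simp add: monom_Suc)
  thus ?case using Suc by (simp add: pairing_X funpow_Suc_right del: funpow.simps)
qed (simp add: monom_0 flip: one_pCons)

text \<open>The matrix has lower bandwidth p, so each application extends the support by at most
  p.\<close>

lemma funpow_toeplitz_support:
  assumes "\<And>i. i \<ge> j \<Longrightarrow> v i = 0" and "i \<ge> j + k * p"
  shows "(mat_apply (toeplitz p a) ^^ k) v i = 0"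
  using assms(2)
proof (induction k arbitrary: i)
  case (Suc k)
  thus ?case by (auto simp: mat_apply_toeplitz intro!: sum.neutral)
qed (use assms(1) in auto)

lemma L_functional_Q:
  assumes j: "j \<in> {1..p}" and k: "k < multi_index p n j"
  shows "L_functional p a j (monom 1 k * Q (int n)) = 0"
proof -
  define v where "v = (\<lambda>i. \<Sum>l<j. basis_vec l i)"
  have "L_functional p a j (monom 1 k * Q (int n)) = pairing (monom 1 k * Q (int n)) v"
    by (simp add: L_functional_def L_moment_def pairing_def v_def ell2_inner_basis_0)
  also have "\<dots> = (mat_apply (toeplitz p a) ^^ k) v n"
    by (simp add: pairing_monom_mult pairing_Q)
  also have "\<dots> = 0"
    using j k multi_index_le_iff[of j p k n]
    by (intro funpow_toeplitz_support[of j]) (auto simp: v_def basis_vec_def)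
  finally show ?thesis .
qed

section \<open>Order of the Hermite-Pade remainder at infinity\<close>

lemma z_0_bigo: "z 0 \<in> O[at_infinity](\<lambda>l. 1 / l)"
proof -
  obtain B where B: "B > 0" "\<And>l. cmod l \<ge> B \<Longrightarrow> cmod (z 0 l) \<le> 2 / cmod l"
    using z_0_small by blast
  show ?thesis
    by (rule bigoI[of _ 2]) (use B in \<open>auto simp: eventually_at_infinity norm_divide\<close>)
qed

lemma inverse_power_bigo:
  assumes "m \<le> n"
  shows "(\<lambda>l::complex. (1 / l) ^ n) \<in> O[at_infinity](\<lambda>l. (1 / l) ^ m)"
proof (rule bigoI[of _ 1])
  have "eventually (\<lambda>l::complex. cmod l \<ge> 1) at_infinity"
    by (auto simp: eventually_at_infinity)
  thus "\<forall>\<^sub>F l in at_infinity. cmod ((1 / l) ^ n) \<le> 1 * cmod ((1 / l :: complex) ^ m)"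
    by eventually_elim
      (use assms in \<open>auto simp: norm_power norm_divide divide_le_eq intro!: power_decreasing\<close>)
qed

text \<open>Every use of \<open>h_rec\<close> goes back at most p indices and gains a factor z_0 =
  O(1/l). The hypothesis says that m is at most n/p rounded up.\<close>

lemma h_bigo:
  assumes "int m * int p < n + int p"
  shows "(\<lambda>l. h l (z 0 l) n) \<in> O[at_infinity](\<lambda>l. (1 / l) ^ m)"
  using assms
\<comment> \<open>The shift by p turns the admissible range n > -p into positive naturals, so the
  vanishing negative indices serve as base cases.\<close>
proof (induction "nat (n + int p)" arbitrary: n m rule: less_induct)
  case less
  have "n > - int p" using less.prems by (smt (verit) of_nat_0_le_iff zero_le_mult_iff)
  consider "n < 0" | "n = 0" | "n \<ge> 1" by linarith
  thus ?case
  proof cases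
    case 1
    thus ?thesis using \<open>n > - int p\<close> by (simp add: h_neg)
  next
    case 2
    hence "m * p < 1 * p" using less.prems by (simp flip: of_nat_mult)
    hence "m = 0" by (simp only: mult_less_cancel2) simp
    thus ?thesis using 2 by (simp add: h_0)
  next
    case 3
    have "(\<lambda>l. z 0 l ^ (k - i) * h l (z 0 l) (n - 1 - int i)) \<in> O[at_infinity](\<lambda>l. (1 / l) ^ m)"
      if k: "k \<le> p" "i < k" for k i
    \<comment> \<open>For m > 0 the earlier \<open>h\<close> is used with exponent m - 1 and z_0
      supplies the missing order; for m = 0 boundedness suffices.\<close>
    proof (cases m)
      case 0
      have "(\<lambda>l. z 0 l ^ (k - i) * h l (z 0 l) (n - 1 - int i)) \<in>
          O[at_infinity](\<lambda>l. (1 / l) ^ (k - i) * (1 / l) ^ 0)"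
        using 3 k by (intro landau_o.big.mult landau_o.big_power z_0_bigo less) auto
      also have "(\<lambda>l::complex. (1 / l) ^ (k - i) * (1 / l) ^ 0) \<in> O[at_infinity](\<lambda>l. (1 / l) ^ m)"
        using 0 inverse_power_bigo[of 0 "k - i"] by simp
      finally show ?thesis .
    next
      case (Suc m')
      have "(\<lambda>l. z 0 l ^ (k - i) * h l (z 0 l) (n - 1 - int i)) \<in>
          O[at_infinity](\<lambda>l. (1 / l) ^ (k - i) * (1 / l) ^ m')"
        using 3 k Suc less.prems
        by (intro landau_o.big.mult landau_o.big_power z_0_bigo less) (auto simp: algebra_simps)
      also have "(\<lambda>l::complex. (1 / l) ^ (k - i) * (1 / l) ^ m') \<in> O[at_infinity](\<lambda>l. (1 / l) ^ m)"
        unfolding power_add[symmetric] using k Suc by (intro inverse_power_bigo) auto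
      finally show ?thesis .
    qed
    hence "(\<lambda>l. \<Sum>k\<le>p. a k * (\<Sum>i<k. z 0 l ^ (k - i) * h l (z 0 l) (n - 1 - int i)))
        \<in> O[at_infinity](\<lambda>l. (1 / l) ^ m)"
      by (intro big_sum_in_bigo landau_o.big.mult_in_1 landau_o.big.mult_left) (auto intro!: landau_o.big.cmult_in_iff' big_sum_in_bigo)
    also have "(\<lambda>l. \<Sum>k\<le>p. a k * (\<Sum>i<k. z 0 l ^ (k - i) * h l (z 0 l) (n - 1 - int i))) =
        (\<lambda>l. h l (z 0 l) n)"
      using z_nonzero[of 0] z_root[of 0] 3 by (intro ext h_rec[symmetric]) auto
    finally show ?thesis .
  qed
qed

lemma hermite_pade:
  "type_II_hermite_pade p (multi_index p n) (\<lambda>j l. z 0 l ^ j) (Q (int n)) (\<lambda>j. Q (int n - int j))"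
  unfolding type_II_hermite_pade_def
proof (intro conjI ballI)
  show "Q (int n) \<noteq> 0" using degree_Q[of n] by auto
  show "degree (Q (int n)) \<le> (\<Sum>j=1..p. multi_index p n j)"
    using degree_Q[of n] sum_multi_index[OF p_pos] by simp
  fix j assume j: "j \<in> {1..p}"
  define N where "N = multi_index p n j"
  \<comment> \<open>The case N = 0 is kept apart because N - 1 is truncated. Otherwise this bound
    and i < j give N p < n - i + p, as \<open>h_bigo\<close> requires; the last order comes from the
    factor z_0^(j-i).\<close>
  have N: "N = 0 \<or> (N - 1) * p + j \<le> n"
    using multi_index_le_iff[of j p "N - 1" n] j by (auto simp: N_def)
  have "(\<lambda>l. z 0 l ^ (j - i) * h l (z 0 l) (int n - int i)) \<in> O[at_infinity](\<lambda>l. (1 / l) ^ (N + 1))"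
    if i: "i < j" for i
  proof -
    have "int N * int p < int n - int i + int p"
    proof (cases N)
      case (Suc N')
      have "N * p + j \<le> n + p" using N Suc by simp
      hence "int N * int p + int j \<le> int n + int p"
        by (metis of_nat_add of_nat_le_iff of_nat_mult)
      thus ?thesis using i by linarith
    qed (use i j in auto)
    hence "(\<lambda>l. z 0 l ^ (j - i) * h l (z 0 l) (int n - int i)) \<in>
        O[at_infinity](\<lambda>l. (1 / l) ^ (j - i) * (1 / l) ^ N)"
      by (intro landau_o.big.mult landau_o.big_power z_0_bigo h_bigo)
    also have "(\<lambda>l::complex. (1 / l) ^ (j - i) * (1 / l) ^ N) \<in> O[at_infinity](\<lambda>l. (1 / l) ^ (N + 1))"
      unfolding power_add[symmetric] using i by (intro inverse_power_bigo) auto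
    finally show ?thesis .
  qed
  hence "(\<lambda>l. \<Sum>i<j. z 0 l ^ (j - i) * h l (z 0 l) (int n - int i)) \<in> O[at_infinity](\<lambda>l. (1 / l) ^ (N + 1))"
    by (intro big_sum_in_bigo) auto
  thus "(\<lambda>l. q (int n) l * z 0 l ^ j - q (int n - int j) l)
      \<in> O[at_infinity](\<lambda>l. 1 / l ^ (multi_index p n j + 1))"
    using z_nonzero[of 0] by (simp add: telescope power_one_over N_def)
qed

section \<open>The resolvent functions\<close>

text \<open>The shifted sequence satisfies the eigenvalue equation in every row but j - 1, where the
  superdiagonal entry meets Q_0 = 1. For j = 0 there is no exceptional row.\<close>

lemma toeplitz_Q_shift:
  assumes "j \<le> p"
  shows "mat_apply (toeplitz p a) (\<lambda>n. q (int n - int j) l) i =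
    l * q (int i - int j) l + (if Suc i = j then 1 else 0)"
proof (cases "j \<le> i")
  case True
  have "(\<Sum>k\<le>p. if k \<le> i then a k * q (int (i - k) - int j) l else 0) =
      (\<Sum>k\<le>p. a k * q (int i - int j - int k) l)"
  proof (intro sum.cong refl)
    fix k assume "k \<in> {..p}"
    thus "(if k \<le> i then a k * q (int (i - k) - int j) l else 0) = a k * q (int i - int j - int k) l"
      using True Q_neg[of "int i - int j - int k"] by (auto simp: of_nat_diff algebra_simps)
  qed
  thus ?thesis
    using q_rec[of "int i - int j" l] True by (simp add: mat_apply_toeplitz algebra_simps)
next
  case False
  have "(\<Sum>k\<le>p. if k \<le> i then a k * q (int (i - k) - int j) l else 0) = 0"
    using False assms by (intro sum.neutral) (auto simp: Q_neg of_nat_diff)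
  moreover have "q (int (Suc i) - int j) l = (if Suc i = j then 1 else 0)"
    using False assms Q_neg[of "int (Suc i) - int j"] by (auto simp: Q_0)
  moreover have "Q (int i - int j) = 0"
    using False assms by (intro Q_neg) auto
  ultimately show ?thesis by (simp add: mat_apply_toeplitz)
qed

lemma toeplitz_diff:
  "mat_apply (toeplitz p a) (\<lambda>n. x n - y n) i = mat_apply (toeplitz p a) x i - mat_apply (toeplitz p a) y i"
proof -
  have "(\<Sum>k\<le>p. if k \<le> i then a k * (x (i - k) - y (i - k)) else 0) =
      (\<Sum>k\<le>p. (if k \<le> i then a k * x (i - k) else 0) - (if k \<le> i then a k * y (i - k) else 0))"
    by (intro sum.cong) (auto simp: right_diff_distrib)
  thus ?thesis by (simp add: mat_apply_toeplitz sum_subtractf)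
qed

lemma toeplitz_scale:
  "mat_apply (toeplitz p a) (\<lambda>n. x n * c) i = mat_apply (toeplitz p a) x i * c"
  by (auto simp: mat_apply_toeplitz distrib_right sum_distrib_right intro!: sum.cong)

text \<open>Row i determines the entry i + 1 from the earlier ones by the recurrence of Q. This
  describes the kernel of l I - A.\<close>

lemma toeplitz_eigenvector:
  assumes "\<And>i. l * x i = mat_apply (toeplitz p a) x i"
  shows "x n = x 0 * q (int n) l"
proof (induction n rule: less_induct)
  case (less n)
  show ?case
  proof (cases n)
    case 0
    thus ?thesis by (simp add: Q_0)
  next
    case (Suc m)
    have "(\<Sum>k\<le>p. if k \<le> m then a k * x (m - k) else 0) =
        (\<Sum>k\<le>p. x 0 * (a k * q (int m - int k) l))"
    proof (intro sum.cong refl)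
      fix k assume "k \<in> {..p}"
      thus "(if k \<le> m then a k * x (m - k) else 0) = x 0 * (a k * q (int m - int k) l)"
        using less[of "m - k"] Suc Q_neg[of "int m - int k"] by (auto simp: of_nat_diff)
    qed
    hence "x n = l * x m - x 0 * (\<Sum>k\<le>p. a k * q (int m - int k) l)"
      using assms[of m] Suc by (simp add: mat_apply_toeplitz sum_distrib_left)
    also have "\<dots> = x 0 * (l * q (int m) l - (\<Sum>k\<le>p. a k * q (int m - int k) l))"
      using less[of m] Suc by (simp add: right_diff_distrib)
    also have "\<dots> = x 0 * q (int n) l"
      using q_rec[of "int m" l] Suc by (simp add: add.commute)
    finally show ?thesis .
  qed
qed

text \<open>By \<open>toeplitz_Q_shift\<close> the sequence \<open>x\<close> is mapped to the
  required unit vector, and telescoping with the decay of \<open>h\<close> puts it in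
  \<open>ell2\<close>. It is the only preimage, since kernel elements are multiples of q_n, which
  stays away from 0. Its entry at 0 is z_0^j because Q_(-j) = 0.\<close>

lemma resolvent_fun_eq:
  assumes j: "j \<in> {1..p}"
    and small: "cmod (z 0 l) \<le> 1 / 4" "A * real p * cmod (z 0 l) \<le> (1 / 2) ^ p"
  shows "resolvent_fun p a j l = z 0 l ^ j"
proof -
  define w where "w = z 0 l"
  have w: "w \<noteq> 0" "symbol p a w = l" using z_nonzero[of 0 l] z_root[of 0 l] by (simp_all add: w_def)
  define f where "f = (\<lambda>x i. l * x i - mat_apply (toeplitz p a) x i)"
  define x where "x = (\<lambda>n. q (int n) l * w ^ j - q (int n - int j) l)"
  have h_le: "cmod (h l w (int n)) \<le> (1 / 2) ^ n" for n
    using small by (intro h_geometric_bound w) (auto simp: w_def)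
  have f_x: "f x = basis_vec (j - 1)"
  proof
    fix i
    have "mat_apply (toeplitz p a) x i =
        mat_apply (toeplitz p a) (\<lambda>n. q (int n) l) i * w ^ j -
        mat_apply (toeplitz p a) (\<lambda>n. q (int n - int j) l) i"
      unfolding x_def by (simp only: toeplitz_diff toeplitz_scale)
    moreover have "l * x i = l * q (int i) l * w ^ j - l * q (int i - int j) l"
      by (simp add: x_def right_diff_distrib)
    ultimately show "f x i = basis_vec (j - 1) i"
      using toeplitz_Q_shift[of 0 l i] toeplitz_Q_shift[of j l i] j
      by (auto simp: f_def basis_vec_def)
  qed
  have x_le: "cmod (x n) \<le> real p * 2 ^ p * (1 / 2) ^ n" for n
  proof -
    have "cmod (x n) \<le> (\<Sum>i<j. 2 ^ p * (1 / 2) ^ n)"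
      unfolding x_def telescope[OF w(1)]
    proof (intro sum_norm_le)
      fix i assume i: "i \<in> {..<j}"
      have "cmod (h l w (int n - int i)) \<le> 2 ^ p * (1 / 2) ^ n"
      proof (cases "i \<le> n")
        case True
        have "cmod (h l w (int n - int i)) \<le> (1 / 2) ^ (n - i)"
          using h_le[of "n - i"] True by (simp add: of_nat_diff)
        also have "\<dots> = 2 ^ i * (1 / 2) ^ n"
          using True by (simp add: power_diff power_one_over field_simps)
        also have "\<dots> \<le> 2 ^ p * (1 / 2) ^ n"
          using i j by (intro mult_right_mono power_increasing) auto
        finally show ?thesis .
      next
        case False
        thus ?thesis using i j by (simp add: h_neg)
      qed
      moreover have "cmod w ^ (j - i) \<le> 1"
        using small by (intro power_le_one) (auto simp: w_def)
      ultimately have "cmod w ^ (j - i) * cmod (h l w (int n - int i)) \<le> 1 * (2 ^ p * (1 / 2) ^ n)"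
        by (intro mult_mono) auto
      thus "cmod (w ^ (j - i) * h l w (int n - int i)) \<le> 2 ^ p * (1 / 2) ^ n"
        by (simp add: norm_mult norm_power)
    qed
    also have "\<dots> = real j * (2 ^ p * (1 / 2) ^ n)" by simp
    also have "\<dots> \<le> real p * (2 ^ p * (1 / 2) ^ n)"
      using j by (intro mult_right_mono) auto
    finally show ?thesis by (simp add: mult.assoc)
  qed
  have x_ell2: "x \<in> ell2"
    unfolding ell2_def mem_Collect_eq
  proof (rule summable_comparison_test)
    show "\<exists>N. \<forall>n\<ge>N. norm ((cmod (x n))\<^sup>2) \<le> (real p * 2 ^ p)\<^sup>2 * (1 / 4) ^ n"
    proof (intro exI allI impI)
      fix n
      have "(cmod (x n))\<^sup>2 \<le> (real p * 2 ^ p * (1 / 2) ^ n)\<^sup>2"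
        by (intro power_mono x_le) auto
      also have "\<dots> = (real p * 2 ^ p)\<^sup>2 * ((1 / 2)\<^sup>2) ^ n"
        by (simp only: power_mult_distrib power_mult[symmetric] mult.commute)
      finally show "norm ((cmod (x n))\<^sup>2) \<le> (real p * 2 ^ p)\<^sup>2 * (1 / 4) ^ n"
        by (simp add: power2_eq_square)
    qed
    show "summable (\<lambda>n. (real p * 2 ^ p)\<^sup>2 * (1 / 4) ^ n)"
      by (intro summable_mult summable_geometric) auto
  qed
  have q_ge: "cmod (q (int n) l) \<ge> 1 / 2" for n
  proof -
    \<comment> \<open>The terms after the first are at most 4^(-i). The subtracted multiple of
      4^(-n) leaves room for the next term in the induction.\<close>
    have "cmod ((\<Sum>i\<le>n. w ^ i * h l w (int i)) - 1) \<le> 1 / 2 - (1 / 2) * (1 / 4) ^ n"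
    proof (induction n)
      case 0
      show ?case by (simp add: h_0)
    next
      case (Suc n)
      have "cmod w ^ Suc n * cmod (h l w (int (Suc n))) \<le> (1 / 4) ^ Suc n * 1"
        using small order.trans[OF h_le, of _ 1] unfolding w_def
        by (intro mult_mono power_mono) (auto simp: power_le_one simp del: of_nat_Suc power_Suc)
      hence "cmod (w ^ Suc n * h l w (int (Suc n))) \<le> (1 / 4) ^ Suc n"
        unfolding norm_mult norm_power by simp
      moreover have "cmod ((\<Sum>i\<le>Suc n. w ^ i * h l w (int i)) - 1) \<le>
          cmod ((\<Sum>i\<le>n. w ^ i * h l w (int i)) - 1) + cmod (w ^ Suc n * h l w (int (Suc n)))"
        using norm_triangle_ineq[of "(\<Sum>i\<le>n. w ^ i * h l w (int i)) - 1" "w ^ Suc n * h l w (int (Suc n))"]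
        by (simp add: algebra_simps)
      moreover have "(0::real) \<le> (1 / 4) ^ n" by simp
      ultimately show ?case using Suc unfolding power_Suc by linarith
    qed
    moreover have "(0::real) \<le> (1 / 4) ^ n" by simp
    ultimately have "cmod (w ^ n * q (int n) l - 1) \<le> 1 / 2"
      unfolding telescope_h[OF w(1)] by linarith
    hence "1 / 2 \<le> cmod (w ^ n * q (int n) l)"
      using norm_triangle_ineq2[of 1 "1 - w ^ n * q (int n) l"] by (simp add: norm_minus_commute)
    also have "\<dots> = cmod w ^ n * cmod (q (int n) l)"
      by (simp add: norm_mult norm_power)
    also have "\<dots> \<le> 1 * cmod (q (int n) l)"
      using small by (intro mult_right_mono power_le_one) (auto simp: w_def)
    finally show ?thesis by simp
  qed
  have "inj_on f ell2"
  proof (rule inj_onI)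
    fix u v assume uv: "u \<in> ell2" "v \<in> ell2" "f u = f v"
    define d where "d = (\<lambda>n. u n - v n)"
    have "l * d i = mat_apply (toeplitz p a) d i" for i
      using fun_cong[OF uv(3), of i] by (simp add: d_def f_def toeplitz_diff algebra_simps)
    hence d: "d n = d 0 * q (int n) l" for n
      by (rule toeplitz_eigenvector)
    have "(\<lambda>n. u n - v n) \<longlonglongrightarrow> 0 - 0"
      using uv by (intro tendsto_diff ell2_tendsto_0)
    hence "d \<longlonglongrightarrow> 0" by (simp add: d_def)
    moreover have "cmod (d 0) / 2 \<le> cmod (d n)" for n
      unfolding d[of n] norm_mult using mult_left_mono[OF q_ge[of n], of "cmod (d 0)"] by simp
    ultimately have "cmod (d 0) / 2 \<le> 0"
      by (intro LIMSEQ_le_const[OF tendsto_norm_zero]) auto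
    hence "d n = 0" for n using d[of n] by simp
    thus "u = v" by (auto simp: d_def)
  qed
  hence "the_inv_into ell2 f (basis_vec (j - 1)) = x"
    using f_x x_ell2 by (intro the_inv_into_f_eq)
  hence "resolvent_fun p a j l = x 0"
    unfolding resolvent_fun_def resolvent_op_def ell2_inner_basis_0 f_def by simp
  also have "\<dots> = w ^ j"
    using j Q_neg[of "- int j"] by (simp add: x_def Q_0)
  finally show ?thesis by (simp add: w_def)
qed

text \<open>Near infinity \<open>z\<^sub>0(1/w)\<close> is the local inverse at \<open>0\<close> of the function \<open>1 / symbol\<close>, which has
  a removable singularity there.\<close>

lemma z_0_local_inverse:
  obtains g where "g analytic_on {0}" "eventually (\<lambda>w. z 0 (1 / w) = g w) (at 0)"
proof -
  \<comment> \<open>This is t a(t) continued to t = 0, where it equals 1; hence \<psi> is 1/a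
    extended by 0, with derivative 1 at 0.\<close>
  define d where "d = (\<lambda>t::complex. 1 + (\<Sum>k\<le>p. a k * t ^ Suc k))"
  define \<psi> where "\<psi> = (\<lambda>t. t / d t)"
  define S where "S = {t. d t \<noteq> 0}"
  have d_cont: "continuous_on UNIV d"
    unfolding d_def by (intro continuous_intros)
  have "open S"
    unfolding S_def using d_cont by (intro open_Collect_neq) (auto intro: continuous_intros)
  have "0 \<in> S" by (simp add: S_def d_def)
  have "d holomorphic_on S"
    unfolding d_def by (intro holomorphic_intros)
  hence hol: "\<psi> holomorphic_on S"
    unfolding \<psi>_def by (intro holomorphic_intros) (auto simp: S_def)
  have "(d has_field_derivative deriv d 0) (at 0)"
    using \<open>d holomorphic_on S\<close> \<open>open S\<close> \<open>0 \<in> S\<close> by (rule holomorphic_derivI)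
  hence "(\<psi> has_field_derivative (1 * d 0 - 0 * deriv d 0) / (d 0 * d 0)) (at 0)"
    unfolding \<psi>_def using \<open>0 \<in> S\<close> by (intro DERIV_divide DERIV_ident) (auto simp: S_def)
  hence "deriv \<psi> 0 \<noteq> 0"
    using \<open>0 \<in> S\<close> by (auto simp: S_def dest!: DERIV_imp_deriv)
  then obtain r where r: "r > 0" "ball 0 r \<subseteq> S" "inj_on \<psi> (ball 0 r)"
    using has_complex_derivative_locally_injective[OF hol \<open>0 \<in> S\<close> \<open>open S\<close>] by blast
  have hol_r: "\<psi> holomorphic_on ball 0 r"
    using hol r(2) by (rule holomorphic_on_subset)
  obtain g where g: "g holomorphic_on (\<psi> ` ball 0 r)" "\<And>t. t \<in> ball 0 r \<Longrightarrow> g (\<psi> t) = t"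
    using holomorphic_has_inverse[OF hol_r open_ball r(3)] by metis
  have "open (\<psi> ` ball 0 r)"
    using open_mapping_thm3[OF hol_r _ r(3)] by simp
  moreover have "0 \<in> \<psi> ` ball 0 r"
    using r(1) by (intro image_eqI[of _ _ 0]) (auto simp: \<psi>_def)
  ultimately have "g analytic_on {0}"
    using g(1) analytic_at by blast
  \<comment> \<open>As z_0 tends to 0, it eventually lies in the ball of injectivity, which
    identifies it with the branch \<open>g\<close>.\<close>
  moreover have "eventually (\<lambda>l. cmod (z 0 l) < r) at_infinity"
    using order_tendstoD(2)[OF tendsto_norm_zero[OF z_0_tendsto] r(1)] .
  hence "eventually (\<lambda>w. cmod (z 0 (inverse w)) < r) (at 0)"
    by (rule eventually_compose_filterlim[OF _ filterlim_inverse_at_infinity])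
  hence "eventually (\<lambda>w. z 0 (1 / w) = g w) (at 0)"
    using eventually_neq_at_within[of 0 0 UNIV]
  proof eventually_elim
    case (elim w)
    define t where "t = z 0 (1 / w)"
    have t: "t \<noteq> 0" "symbol p a t = 1 / w" "t \<in> ball 0 r"
      using z_nonzero[of 0] z_root[of 0] elim by (simp_all add: t_def inverse_eq_divide)
    have "d t = t * symbol p a t"
      using t(1) by (simp add: d_def symbol_def distrib_left sum_distrib_left mult_ac)
    hence "\<psi> t = w"
      using t elim by (simp add: \<psi>_def)
    thus ?case using g(2)[OF t(3)] by (simp add: t_def)
  qed
  ultimately show ?thesis using that by blast
qed

text \<open>A Laurent expansion depends only on values in a punctured neighbourhood of w = 0, where
  \<open>resolvent_fun_eq\<close> applies because z_0(1/w) tends to 0. The local inverse provides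
  the expansion.\<close>

lemma laurent_expansions:
  assumes j: "j \<in> {1..p}"
  shows "\<exists>F. (\<lambda>w. resolvent_fun p a j (1 / w)) has_laurent_expansion F \<and>
        (\<lambda>w. z 0 (1 / w) ^ j) has_laurent_expansion F"
proof -
  obtain g where g: "g analytic_on {0}" "eventually (\<lambda>w. z 0 (1 / w) = g w) (at 0)"
    using z_0_local_inverse by blast
  have "(\<lambda>w. g w ^ j) has_laurent_expansion fps_to_fls (fps_expansion (\<lambda>w. g w ^ j) 0)"
    using g(1) by (intro has_laurent_expansion_fps analytic_at_imp_has_fps_expansion_0 analytic_intros)
  moreover have ev: "eventually (\<lambda>w. g w ^ j = z 0 (1 / w) ^ j) (at 0)"
    using g(2) by eventually_elim simp
  ultimately have z: "(\<lambda>w. z 0 (1 / w) ^ j) has_laurent_expansion fps_to_fls (fps_expansion (\<lambda>w. g w ^ j) 0)"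
    using has_laurent_expansion_cong[OF ev refl] by blast
  have lim: "((\<lambda>l. cmod (z 0 l)) \<longlongrightarrow> 0) at_infinity"
    by (rule tendsto_norm_zero[OF z_0_tendsto])
  hence lim': "((\<lambda>l. A * real p * cmod (z 0 l)) \<longlongrightarrow> 0) at_infinity"
    by (rule tendsto_mult_right_zero)
  have "eventually (\<lambda>l. cmod (z 0 l) < 1 / 4 \<and> A * real p * cmod (z 0 l) < (1 / 2) ^ p) at_infinity"
    using order_tendstoD(2)[OF lim, of "1/4"] order_tendstoD(2)[OF lim', of "(1 / 2) ^ p"]
    by (intro eventually_conj) auto
  hence "eventually (\<lambda>l. resolvent_fun p a j l = z 0 l ^ j) at_infinity"
    by eventually_elim (use resolvent_fun_eq[OF j] in auto)
  hence "eventually (\<lambda>w. resolvent_fun p a j (inverse w) = z 0 (inverse w) ^ j) (at 0)"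
    by (rule eventually_compose_filterlim[OF _ filterlim_inverse_at_infinity])
  hence ev': "eventually (\<lambda>w. z 0 (1 / w) ^ j = resolvent_fun p a j (1 / w)) (at 0)"
    by eventually_elim (simp add: inverse_eq_divide)
  thus ?thesis
    using z has_laurent_expansion_cong[OF ev' refl] by blast
qed

end

theorem theorem1p1:
  fixes p :: nat
    and a :: "nat \<Rightarrow> complex"
    and Q :: "int \<Rightarrow> complex poly"
    and z :: "nat \<Rightarrow> complex \<Rightarrow> complex"
  assumes "p \<ge> 1"
    and "a p \<noteq> 0"
    and "Q_sequence p a Q"
    and "ordered_solutions p a z"
  shows
    "(\<forall>j\<in>{1..p}. \<exists>F.
        (\<lambda>w. resolvent_fun p a j (1 / w)) has_laurent_expansion F \<and>
        (\<lambda>w. z 0 (1 / w) ^ j) has_laurent_expansion F)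
     \<and>
     (\<forall>n. \<forall>j\<in>{1..p}. \<forall>k < multi_index p n j.
        L_functional p a j (monom 1 k * Q (int n)) = 0)
     \<and>
     (\<forall>n. type_II_hermite_pade p (multi_index p n) (\<lambda>j l. z 0 l ^ j)
            (Q (int n)) (\<lambda>j. Q (int n - int j)))
     \<and>
     (\<forall>j\<in>{1..p}. \<forall>K.
        compactin riemann_sphere K \<and> K \<inter> Some ` Gamma1 z = {} \<longrightarrow>
        (\<forall>\<^sub>F n in sequentially. \<forall>l. Some l \<in> K \<longrightarrow> poly (Q (int n)) l \<noteq> 0) \<and>
        uniform_limit K
          (\<lambda>n. sphere_ext (\<lambda>l. poly (Q (int n - int j)) l / poly (Q (int n)) l))
          (sphere_ext (\<lambda>l. z 0 l ^ j)) sequentially)"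
proof -
  interpret hessenberg_toeplitz p a Q z
    by standard (rule assms)+
  show ?thesis
  proof (intro conjI ballI allI impI)
    fix j K assume j: "j \<in> {1..p}" and K: "compactin riemann_sphere K \<and> K \<inter> Some ` Gamma1 z = {}"
    note * = uniform_ratio_convergence[OF j conjunct1[OF K] conjunct2[OF K]]
    show "\<forall>\<^sub>F n in sequentially. \<forall>l. Some l \<in> K \<longrightarrow> poly (Q (int n)) l \<noteq> 0"
      using * by (rule conjunct1)
    show "uniform_limit K
        (\<lambda>n. sphere_ext (\<lambda>l. poly (Q (int n - int j)) l / poly (Q (int n)) l))
        (sphere_ext (\<lambda>l. z 0 l ^ j)) sequentially"
      using * by (rule conjunct2)
  qed (rule laurent_expansions L_functional_Q hermite_pade; assumption)+
qed

end
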